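(* Suppose that a Borel probability measure $\mu$ on a Fréchet space $E$ satisfies the zero-one law. Let $u,v:E\to\mathbb{R}$ be lower semi-continuous $\mu$-integrable functions such that $$\int u\,d\mu>0,\qquad \int v\,d\mu>0.$$ Then there exists a needle $\nu$ of $\mu$ such that $$\int u\,d\nu>0,\qquad \int v\,d\nu>0.$$ Moreover, if $\mu$ is supported on a closed convex set $F$, then $\nu$ may be chosen to be supported on $F$, as well.
   Context: A Fréchet space is a complete metrizable (real) locally convex space. A Borel probability measure $\mu$ on $E$ satisfies the zero-one law if any $\mu$-measurable affine subspace of $E$ has $\mu$-measure either $0$ or $1$. A measure is supported on a closed set if the complement of that set has measure zero. Let $\mu$ be a finite Borel measure on $E$. A Borel probability measure $\nu$ is called a needle of $\mu$ if it is supported on a segment $[a,b]\subset E$ and can be obtained as the weak limit of probability measures $$\mu_l(A)=\frac{1}{\mu(K_l)}\,\mu(A\cap K_l)\qquad(A\text{ Borel}),$$ where $(K_l)_{l\ge1}$ is some decreasing sequence of convex compact sets in $E$ of positive $\mu$-measure such that $\bigcap_l K_l=[a,b]$. Weak convergence $\mu_l\to\nu$ means $\int w\,d\mu_l\to\int w\,d\nu$ for every bounded continuous function $w$ on $E$.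
   Formalization: It is additionally assumed that some compact set has positive μ-measure; this is necessary for any needle to exist, automatic for separable E, and can fail for non-separable E if a measurable cardinal exists. *)

theory Defs
  imports "HOL-Analysis.Analysis" "HOL-Probability.Probability_Measure"
begin

(* The metric is only asserted to exist and is not part of the structure.  Completeness is that of
   the vector topology: for a translation-invariant metric inducing the topology, its Cauchy
   sequences are exactly the Cauchy sequences of the topological vector space, so the choice of
   such a metric is immaterial.  Convexity of V is spelled out (cf. convex_alt) because the constant
   convex is not available inside a class specification. *)
class frechet_space = real_vector + topological_ab_group_add +
  assumes continuous_scaleR:
      "((\<lambda>p. fst p *\<^sub>R snd p) \<longlongrightarrow> r *\<^sub>R x) (nhds (r::real) \<times>\<^sub>F nhds x)"
    and locally_convex:
      "open U \<Longrightarrow> 0 \<in> U \<Longrightarrow> \<exists>V. open V \<and> 0 \<in> V \<and> V \<subseteq> U \<and>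
         (\<forall>x\<in>V. \<forall>y\<in>V. \<forall>t. 0 \<le> t \<and> t \<le> 1 \<longrightarrow> (1 - t) *\<^sub>R x + t *\<^sub>R y \<in> V)"
    and complete_metrizable:
      "\<exists>d. Metric_space UNIV d \<and> (\<forall>x y z. d (x + z) (y + z) = d x y) \<and>
           (\<forall>S. open S \<longleftrightarrow> openin (Metric_space.mtopology UNIV d) S) \<and>
           Metric_space.mcomplete UNIV d"

definition borel_measure :: "'a::topological_space measure \<Rightarrow> bool" where
  "borel_measure M \<longleftrightarrow> sets M = sets borel"

definition supported_on :: "'a::topological_space measure \<Rightarrow> 'a set \<Rightarrow> bool" where
  "supported_on M F \<longleftrightarrow> closed F \<and> emeasure M (- F) = 0"

(* M-measurable sets are the sets measurable for the completion of M. *)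
definition zero_one_law :: "'a::frechet_space measure \<Rightarrow> bool" where
  "zero_one_law M \<longleftrightarrow>
     (\<forall>A. affine A \<and> A \<in> sets (completion M) \<longrightarrow>
          emeasure (completion M) A = 0 \<or> emeasure (completion M) A = 1)"

definition lower_semicontinuous :: "('a::topological_space \<Rightarrow> real) \<Rightarrow> bool" where
  "lower_semicontinuous u \<longleftrightarrow> (\<forall>c. open {x. c < u x})"

definition weakly_converges :: "(nat \<Rightarrow> 'a::topological_space measure) \<Rightarrow> 'a measure \<Rightarrow> bool" where
  "weakly_converges M N \<longleftrightarrow>
     (\<forall>w :: 'a \<Rightarrow> real. continuous_on UNIV w \<and> bounded (range w) \<longrightarrow>
        (\<lambda>l. integral\<^sup>L (M l) w) \<longlonglongrightarrow> integral\<^sup>L N w)"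

(* The segment may degenerate to a point: the only needle of a Dirac measure is the measure
   itself.  uniform_measure M K is the measure A |-> M (A Int K) / M K. *)
definition needle :: "'a::frechet_space measure \<Rightarrow> 'a measure \<Rightarrow> bool" where
  "needle M N \<longleftrightarrow>
     prob_space N \<and> borel_measure N \<and>
     (\<exists>a b. supported_on N (closed_segment a b) \<and>
        (\<exists>K :: nat \<Rightarrow> 'a set.
           decseq K \<and> (\<forall>l. convex (K l) \<and> compact (K l) \<and> 0 < emeasure M (K l)) \<and>
           (\<Inter>l. K l) = closed_segment a b \<and>
           weakly_converges (\<lambda>l. uniform_measure M (K l)) N))"

(* The integral with values in (-infinity, infinity].  A function integrable for M need not be
   integrable for a needle N, where a lower semicontinuous u has a finite negative part (u is
   bounded below on the compact segment) but its positive part may have infinite integral; the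
   Bochner integral would then be 0 by convention.  If both parts are infinite the value is
   meaningless; this does not occur for lower semicontinuous u and a needle. *)
definition ext_integral :: "'a measure \<Rightarrow> ('a \<Rightarrow> real) \<Rightarrow> ereal" where
  "ext_integral N u =
     enn2ereal (\<integral>\<^sup>+ x. ennreal (u x) \<partial>N) - enn2ereal (\<integral>\<^sup>+ x. ennreal (- u x) \<partial>N)"

end

theory Submission
  imports Defs "HOL-Probability.Helly_Selection"
begin

text \<open>
The proof is a localization argument by repeated bisection, in the manner of Lovasz and Simonovits.

By the zero-one law \<open>\<mu>\<close> lives on a \<open>\<sigma>\<close>-compact subspace: if
\<open>C\<close> is a compact set of positive measure and \<open>B\<close> is a symmetric compact convex
set containing it, then the union of the multiples \<open>n *\<^sub>R B\<close> is a Borel subspace of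
positive, hence full, measure (\<open>exhausting_compact_convex\<close>). Consequently \<open>u\<close>
and \<open>v\<close> already have positive integrals over some compact convex \<open>K \<subseteq>
F\<close>. On \<open>K\<close> the functions \<open>u\<close> and \<open>v\<close> are replaced by
bounded continuous minorants \<open>f\<close> and \<open>g\<close>, because for a lower semicontinuous
function weak convergence gives an inequality in the wrong direction; and then by \<open>f -
\<epsilon>\<close>, \<open>g - \<epsilon>\<close>, so that the strict inequalities survive the passage to
the limit.

The heart is \<open>bisection\<close>. Given two continuous linear functionals \<open>l\<close>,
\<open>m\<close> and a point \<open>(p, q)\<close> of the plane, some line through \<open>(p, q)\<close>
pulls back under \<open>(l, m)\<close> to a hyperplane that halves the integral of \<open>f\<close> over
\<open>K\<close>: rotate the line by half a turn and apply the intermediate value theorem. Continuity in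
the angle needs the hyperplanes to be null sets, and here the zero-one law enters a second time: a
hyperplane that is not null carries all the mass, and \<open>K\<close> may be intersected with it at no
cost. One of the two halves also has a positive integral of \<open>g\<close>.

Carry this out successively for all pairs from a countable separating family of functionals and all
rational \<open>(p, q)\<close> (\<open>localization_sequence\<close>). If the intersection of the
resulting sets contained a nondegenerate triangle, some pair \<open>(l, m)\<close> would map it to a
nondegenerate triangle of the plane, with a rational point in its interior, and the cut through that
point would have removed at least one vertex. So the intersection is collinear, that is, a segment.

Finally, normalized restrictions of \<open>\<mu>\<close> to compact sets decreasing to a segment have a
weak cluster point on the segment. The segment is parametrized by a continuous functional, which reduces
this to Helly's theorem on the real line (\<open>uniform_measures_cluster_on_segment\<close>).
\<close>

section \<open>Topology of Frechet spaces\<close>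

lemma frechet_metric:
  obtains d :: "'a::frechet_space \<Rightarrow> 'a \<Rightarrow> real"
  where "Metric_space UNIV d" "\<forall>x y z. d (x + z) (y + z) = d x y"
    "Metric_space.mtopology UNIV d = euclidean" "Metric_space.mcomplete UNIV d"
proof -
  obtain d :: "'a \<Rightarrow> 'a \<Rightarrow> real" where d: "Metric_space UNIV d" "\<forall>x y z. d (x + z) (y + z) = d x y"
    "\<And>S. open S \<longleftrightarrow> openin (Metric_space.mtopology UNIV d) S" "Metric_space.mcomplete UNIV d"
    using complete_metrizable by blast
  moreover have "Metric_space.mtopology UNIV d = euclidean"
    by (simp add: topology_eq d(3) flip: open_openin)
  ultimately show thesis using that by blast
qed

text \<open>
The separation axiom makes compact sets closed, and therefore Borel.
\<close>

instance frechet_space \<subseteq> t2_space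
proof
  fix x y :: 'a
  assume "x \<noteq> y"
  obtain d :: "'a \<Rightarrow> 'a \<Rightarrow> real" where d: "Metric_space UNIV d"
    "Metric_space.mtopology UNIV d = euclidean" by (rule frechet_metric)
  interpret Metric_space UNIV d by fact
  have "Hausdorff_space (euclidean :: 'a topology)"
    using Hausdorff_space_mtopology d(2) by simp
  then show "\<exists>U V. open U \<and> open V \<and> x \<in> U \<and> y \<in> V \<and> U \<inter> V = {}"
    using \<open>x \<noteq> y\<close> by (fastforce simp: Hausdorff_space_def disjnt_def)
qed

lemma continuous_on_scaleR_frechet [continuous_intros]:
  fixes g :: "'b::topological_space \<Rightarrow> 'a::frechet_space"
  assumes "continuous_on S f" "continuous_on S g"
  shows "continuous_on S (\<lambda>x. f x *\<^sub>R g x)"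
  unfolding continuous_on_def
proof
  fix x assume "x \<in> S"
  then have "(f \<longlongrightarrow> f x) (at x within S)" "(g \<longlongrightarrow> g x) (at x within S)"
    using assms by (auto simp: continuous_on_def)
  then have "((\<lambda>y. (f y, g y)) \<longlongrightarrow> (f x, g x)) (at x within S)"
    by (rule tendsto_Pair)
  with continuous_scaleR[of "f x" "g x"]
  show "((\<lambda>x. f x *\<^sub>R g x) \<longlongrightarrow> f x *\<^sub>R g x) (at x within S)"
    by (subst (asm) nhds_prod[symmetric]) (drule (1) filterlim_compose, simp)
qed

lemma convex_nbhd:
  fixes U :: "'a::frechet_space set"
  assumes "open U" "0 \<in> U"
  obtains V where "open V" "0 \<in> V" "V \<subseteq> U" "convex V"
  using locally_convex[OF assms] by (auto simp: convex_alt)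

lemma open_translation_frechet:
  fixes V :: "'a::frechet_space set"
  assumes "open V" shows "open ((+) x ` V)"
proof -
  have "(+) x ` V = (\<lambda>y. y - x) -` V"
    by (auto simp: image_iff) (metis add.commute diff_add_cancel)
  moreover have "open ((\<lambda>y. y - x) -` V)"
    by (intro open_vimage assms continuous_intros)
  ultimately show ?thesis by simp
qed

lemma nbhd_sum_subset:
  fixes U :: "'a::frechet_space set"
  assumes "open U" "0 \<in> U"
  obtains V where "open V" "0 \<in> V" "convex V" "\<And>x y. x \<in> V \<Longrightarrow> y \<in> V \<Longrightarrow> x + y \<in> U"
proof -
  obtain V where V: "open V" "0 \<in> V" "V \<subseteq> U" "convex V" by (rule convex_nbhd[OF assms])
  let ?W = "(\<lambda>x. 2 *\<^sub>R x) -` V"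
  have "open ?W" by (intro open_vimage V continuous_intros)
  moreover have "convex ?W" by (intro convex_linear_vimage V linear_scaleR)
  moreover have "x + y \<in> U" if "x \<in> ?W" "y \<in> ?W" for x y
  proof -
    have "(1/2) *\<^sub>R (2 *\<^sub>R x) + (1/2) *\<^sub>R (2 *\<^sub>R y) \<in> V"
      using that by (intro convexD[OF V(4)]) auto
    then show ?thesis using V(3) by auto
  qed
  ultimately show ?thesis using V(2) by (intro that[of ?W]) auto
qed

section \<open>Compactness of closed convex hulls\<close>

lemma compact_convex_hull_finite:
  fixes S :: "'a::frechet_space set"
  assumes "finite S" shows "compact (convex hull S)"
  using assms
proof (induction S)
  case (insert a S)
  show ?case
  proof (cases "S = {}")
    case False
    have eq: "convex hull insert a S =
        (\<lambda>(t, b). (1 - t) *\<^sub>R a + t *\<^sub>R b) ` ({0..1::real} \<times> (convex hull S))" (is "_ = ?R")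
    proof (intro equalityI subsetI)
      fix x assume "x \<in> convex hull insert a S"
      then obtain u v b where *: "u \<ge> 0" "v \<ge> 0" "u + v = 1" "b \<in> convex hull S"
        "x = u *\<^sub>R a + v *\<^sub>R b"
        using False by (auto simp: convex_hull_insert)
      then have "x = (\<lambda>(t, b). (1 - t) *\<^sub>R a + t *\<^sub>R b) (v, b)" "v \<in> {0..1}"
        by (auto simp: eq_diff_eq[symmetric])
      then show "x \<in> ?R" using *(4) by blast
    next
      fix x assume "x \<in> ?R"
      then obtain t b where "0 \<le> t" "t \<le> 1" "b \<in> convex hull S" "x = (1 - t) *\<^sub>R a + t *\<^sub>R b" by auto
      then show "x \<in> convex hull insert a S"
        unfolding convex_hull_insert[OF False]
        by (intro CollectI exI[of _ "1 - t"] exI[of _ t] exI[of _ b]) auto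
    qed
    show ?thesis unfolding eq split_beta
      by (intro compact_continuous_image compact_Times insert.IH continuous_intros) auto
  qed auto
qed auto

text \<open>
Cover \<open>C\<close> by translates of a small convex \<open>V\<close> at finitely many points.  Then \<open>C\<close>, and with it its
convex hull, lies in the sum of \<open>V\<close> and the polytope spanned by these points, and the polytope is
compact, hence covered by finitely many translates of \<open>V\<close> in turn.
\<close>

lemma totally_bounded_convex_hull:
  fixes C U :: "'a::frechet_space set"
  assumes "compact C" "open U" "0 \<in> U"
  shows "\<exists>T. finite T \<and> convex hull C \<subseteq> (\<Union>x\<in>T. (+) x ` U)"
proof -
  obtain V where V: "open V" "0 \<in> V" "convex V" "\<And>x y. x \<in> V \<Longrightarrow> y \<in> V \<Longrightarrow> x + y \<in> U"
    by (rule nbhd_sum_subset[OF assms(2,3)]) blast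
  have cover: "\<exists>T. finite T \<and> K \<subseteq> (\<Union>x\<in>T. (+) x ` V)" if K: "compact K" for K
  proof -
    have o: "open ((+) x ` V)" if "x \<in> K" for x using V(1) by (rule open_translation_frechet)
    have cov: "K \<subseteq> (\<Union>x\<in>K. (+) x ` V)"
      using V(2) by (fastforce simp: image_iff)
    obtain T where "T \<subseteq> K" "finite T" "K \<subseteq> (\<Union>x\<in>T. (+) x ` V)"
      by (rule compactE_image[OF K o cov])
    then show ?thesis by blast
  qed
  obtain T where T: "finite T" "C \<subseteq> (\<Union>x\<in>T. (+) x ` V)" using cover[OF assms(1)] by blast
  obtain S where S: "finite S" "convex hull T \<subseteq> (\<Union>x\<in>S. (+) x ` V)"
    using cover[OF compact_convex_hull_finite[OF T(1)]] by blast
  have "convex (\<Union>x\<in>convex hull T. \<Union>y\<in>V. {x + y})"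
    by (intro convex_sums convex_convex_hull V)
  moreover have "C \<subseteq> (\<Union>x\<in>convex hull T. \<Union>y\<in>V. {x + y})"
    using T(2) by (fastforce intro: hull_inc)
  ultimately have "convex hull C \<subseteq> (\<Union>x\<in>convex hull T. \<Union>y\<in>V. {x + y})"
    by (rule hull_minimal[rotated])
  also have "\<dots> \<subseteq> (\<Union>x\<in>S. (+) x ` U)"
  proof clarsimp
    fix x y assume "x \<in> convex hull T" "y \<in> V"
    then obtain s v where "s \<in> S" "v \<in> V" "x = s + v" using S(2) by blast
    then show "\<exists>s\<in>S. x + y \<in> (+) s ` U"
      using V(4)[of v y] \<open>y \<in> V\<close> by (intro bexI[of _ s]) (auto simp: add.assoc)
  qed
  finally show ?thesis using S(1) by blast
qed

text \<open>
This is Mazur's theorem, and the place where completeness enters: translation invariance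
of the metric turns the covers by translates of a neighbourhood into covers by balls of equal radius.
\<close>

lemma compact_closure_convex_hull:
  fixes C :: "'a::frechet_space set"
  assumes "compact C"
  shows "compact (closure (convex hull C))"
proof -
  obtain d :: "'a \<Rightarrow> 'a \<Rightarrow> real" where d: "Metric_space UNIV d" "\<forall>x y z. d (x + z) (y + z) = d x y"
    "Metric_space.mtopology UNIV d = euclidean" "Metric_space.mcomplete UNIV d"
    by (rule frechet_metric)
  interpret Metric_space UNIV d by fact
  have "mtotally_bounded (convex hull C)"
    unfolding mtotally_bounded_def
  proof (intro allI impI)
    fix \<epsilon> :: real assume "\<epsilon> > 0"
    let ?U = "mball 0 (\<epsilon>/2)" and ?H = "convex hull C"
    have "open ?U" using openin_mball[of 0 "\<epsilon>/2"] by (simp add: d(3) flip: open_openin)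
    moreover have "0 \<in> ?U" using \<open>\<epsilon> > 0\<close> by simp
    ultimately obtain T where T: "finite T" "?H \<subseteq> (\<Union>x\<in>T. (+) x ` ?U)"
      using totally_bounded_convex_hull[OF assms, of ?U] by auto
    have ball: "d x y < \<epsilon>/2" if mem: "y \<in> (+) x ` ?U" for x y
    proof -
      obtain u where "y = x + u" "u \<in> ?U" using mem by blast
      then show ?thesis using d(2)[rule_format, of 0 x u] by (simp add: add.commute)
    qed
    define p where "p t = (SOME y. y \<in> ?H \<and> y \<in> (+) t ` ?U)" for t
    have p: "p t \<in> ?H \<and> p t \<in> (+) t ` ?U" if "y \<in> ?H" "y \<in> (+) t ` ?U" for y t
      unfolding p_def using that by (rule_tac someI) blast
    \<comment> \<open>Total boundedness asks for centres in the set itself, which doubles the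
      radius.\<close>
    let ?K = "p ` {t \<in> T. ?H \<inter> (+) t ` ?U \<noteq> {}}"
    have "?H \<subseteq> (\<Union>x\<in>?K. mball x \<epsilon>)"
    proof
      fix y assume y: "y \<in> ?H"
      then obtain t where t: "t \<in> T" "y \<in> (+) t ` ?U" using T(2) by blast
      have "d t y < \<epsilon>/2" by (rule ball[OF t(2)])
      moreover have pt: "p t \<in> ?H" "d t (p t) < \<epsilon>/2"
        using p[OF y t(2)] ball by blast+
      ultimately have "d (p t) y < \<epsilon>"
        using triangle[of "p t" t y] commute[of t "p t"] by simp
      moreover have "p t \<in> ?K" using t y by blast
      ultimately show "y \<in> (\<Union>x\<in>?K. mball x \<epsilon>)"
        by (intro UN_I[of "p t"]) simp_all
    qed
    moreover have "finite ?K" using T(1) by simp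
    moreover have "?K \<subseteq> ?H" using p by blast
    ultimately show "\<exists>K. finite K \<and> K \<subseteq> ?H \<and> ?H \<subseteq> (\<Union>x\<in>K. mball x \<epsilon>)" by blast
  qed
  then have "compactin mtopology (mtopology closure_of (convex hull C))"
    using mtotally_bounded_eq_compact_closure_of[OF d(4)] by blast
  then show ?thesis by (simp add: d(3))
qed

section \<open>Continuous linear functionals\<close>

definition sublinear :: "('a::real_vector \<Rightarrow> real) \<Rightarrow> bool" where
  "sublinear p \<longleftrightarrow> (\<forall>x y. p (x + y) \<le> p x + p y) \<and> (\<forall>t x. 0 \<le> t \<longrightarrow> p (t *\<^sub>R x) = t * p x)"

lemma sublinearI:
  assumes "\<And>x y. p (x + y) \<le> p x + p y" "\<And>t x. 0 < t \<Longrightarrow> p (t *\<^sub>R x) \<le> t * p x" "p 0 = 0"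
  shows "sublinear p"
  unfolding sublinear_def
proof (intro conjI allI impI assms(1))
  fix t :: real and x assume "0 \<le> t"
  show "p (t *\<^sub>R x) = t * p x"
  proof (cases "t = 0")
    case False
    then have "0 < t" using \<open>0 \<le> t\<close> by simp
    then have "p ((1/t) *\<^sub>R (t *\<^sub>R x)) \<le> (1/t) * p (t *\<^sub>R x)" by (intro assms(2)) auto
    then have "t * p x \<le> p (t *\<^sub>R x)" using \<open>0 < t\<close> by (simp add: field_simps)
    then show ?thesis using assms(2)[OF \<open>0 < t\<close>, of x] by simp
  qed (simp add: assms(3))
qed

lemma sublinear_add: "sublinear p \<Longrightarrow> p (x + y) \<le> p x + p y"
  and sublinear_scale: "sublinear p \<Longrightarrow> 0 \<le> t \<Longrightarrow> p (t *\<^sub>R x) = t * p x"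
  and sublinear_0: "sublinear p \<Longrightarrow> p 0 = 0"
  and sublinear_minus: "sublinear p \<Longrightarrow> - p (- x) \<le> p x"
proof -
  show 1: "sublinear p \<Longrightarrow> p (x + y) \<le> p x + p y" for x y by (simp add: sublinear_def)
  show 2: "sublinear p \<Longrightarrow> 0 \<le> t \<Longrightarrow> p (t *\<^sub>R x) = t * p x" for t x by (simp add: sublinear_def)
  show 3: "sublinear p \<Longrightarrow> p 0 = 0" using 2[of 0 0] by simp
  show "sublinear p \<Longrightarrow> - p (- x) \<le> p x" using 1[of x "-x"] 3 by simp
qed

text \<open>
Minorants of this kind serve twice: a minimal sublinear functional must coincide with \<open>r\<close> and is
therefore odd, and a linear functional below \<open>r\<close> attains the value \<open>q a\<close> at \<open>a\<close>.
\<close>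

lemma sublinear_directional:
  assumes "sublinear q"
  shows "\<exists>r. sublinear r \<and> r \<le> q \<and> r (- a) \<le> - q a"
proof -
  note q = assms
  \<comment> \<open>The choice \<open>t = 0\<close> shows \<open>r \<le> q\<close>, the choice
    \<open>t = 1\<close> the bound at \<open>- a\<close>.\<close>
  define r where "r x = (INF t\<in>{0..}. q (x + t *\<^sub>R a) - t * q a)" for x
  have bdd: "bdd_below ((\<lambda>t. q (x + t *\<^sub>R a) - t * q a) ` {0..})" for x
  proof (rule bdd_belowI2)
    fix t :: real assume "t \<in> {0..}"
    then show "- q (- x) \<le> q (x + t *\<^sub>R a) - t * q a"
      using sublinear_add[OF q, of "x + t *\<^sub>R a" "- x"] sublinear_scale[OF q, of t a] by simp
  qed
  have le: "r x \<le> q (x + t *\<^sub>R a) - t * q a" if "0 \<le> t" for x t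
    unfolding r_def using that by (intro cINF_lower bdd) auto
  have ge: "c \<le> r x" if "\<And>t. 0 \<le> t \<Longrightarrow> c \<le> q (x + t *\<^sub>R a) - t * q a" for c x
    unfolding r_def using that by (intro cINF_greatest) auto
  have "sublinear r"
  proof (rule sublinearI)
    fix x y
    have "r (x + y) - r x \<le> r y"
    proof (rule ge)
      fix t :: real assume t: "0 \<le> t"
      have "r (x + y) - (q (y + t *\<^sub>R a) - t * q a) \<le> r x"
      proof (rule ge)
        fix s :: real assume s: "0 \<le> s"
        have "r (x + y) \<le> q (x + y + (s + t) *\<^sub>R a) - (s + t) * q a"
          using s t by (intro le) auto
        also have "q (x + y + (s + t) *\<^sub>R a) \<le> q (x + s *\<^sub>R a) + q (y + t *\<^sub>R a)"
          using sublinear_add[OF q, of "x + s *\<^sub>R a" "y + t *\<^sub>R a"] by (simp add: algebra_simps)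
        finally show "r (x + y) - (q (y + t *\<^sub>R a) - t * q a) \<le> q (x + s *\<^sub>R a) - s * q a"
          by (simp add: algebra_simps)
      qed
      then show "r (x + y) - r x \<le> q (y + t *\<^sub>R a) - t * q a" by simp
    qed
    then show "r (x + y) \<le> r x + r y" by simp
  next
    fix t :: real and x assume t: "0 < t"
    have "r (t *\<^sub>R x) / t \<le> r x"
    proof (rule ge)
      fix s :: real assume s: "0 \<le> s"
      have "r (t *\<^sub>R x) \<le> q (t *\<^sub>R x + (t * s) *\<^sub>R a) - (t * s) * q a"
        using s t by (intro le) auto
      also have "q (t *\<^sub>R x + (t * s) *\<^sub>R a) = t * q (x + s *\<^sub>R a)"
        using sublinear_scale[OF q, of t "x + s *\<^sub>R a"] t by (simp add: algebra_simps)
      finally show "r (t *\<^sub>R x) / t \<le> q (x + s *\<^sub>R a) - s * q a"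
        using t by (simp add: field_simps)
    qed
    then show "r (t *\<^sub>R x) \<le> t * r x" using t by (simp add: field_simps)
  next
    have "r 0 \<le> 0" using le[of 0 0] sublinear_0[OF q] by simp
    moreover have "0 \<le> r 0" by (rule ge) (simp add: sublinear_scale[OF q])
    ultimately show "r 0 = 0" by simp
  qed
  moreover have "r \<le> q" using le[of 0] by (simp add: le_fun_def)
  moreover have "r (- a) \<le> - q a" using le[of 1 "- a"] sublinear_0[OF q] by simp
  ultimately show ?thesis by blast
qed

text \<open>
The pointwise infimum of a chain is subadditive because two members of the chain can always be
replaced by the smaller one; the common bound \<open>p\<close> keeps it finite, as \<open>- p (- x)\<close> lies below
every member at \<open>x\<close>.
\<close>

lemma sublinear_Inf_chain:
  assumes C: "C \<noteq> {}" "\<And>q. q \<in> C \<Longrightarrow> sublinear q" "\<And>q. q \<in> C \<Longrightarrow> q \<le> p"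
    and chain: "\<And>q r. q \<in> C \<Longrightarrow> r \<in> C \<Longrightarrow> q \<le> r \<or> r \<le> q"
  shows "\<exists>m. sublinear m \<and> (\<forall>q\<in>C. m \<le> q)"
proof -
  define m where "m x = (INF q\<in>C. q x)" for x
  have bdd: "bdd_below ((\<lambda>q. q x) ` C)" for x
  proof (rule bdd_belowI2)
    fix q assume "q \<in> C"
    then show "- p (- x) \<le> q x"
      using sublinear_minus[OF C(2), of q x] le_funD[OF C(3), of q "- x"] by simp
  qed
  have le: "m x \<le> q x" if "q \<in> C" for x q
    unfolding m_def using that by (intro cINF_lower bdd) auto
  have ge: "c \<le> m x" if "\<And>q. q \<in> C \<Longrightarrow> c \<le> q x" for c x
    unfolding m_def using that C(1) by (intro cINF_greatest) auto
  have "sublinear m"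
  proof (rule sublinearI)
    fix x y
    have "m (x + y) - m x \<le> m y"
    proof (rule ge)
      fix r assume r: "r \<in> C"
      have "m (x + y) - r y \<le> m x"
      proof (rule ge)
        fix q assume q: "q \<in> C"
        obtain s where s: "s \<in> C" "s \<le> q" "s \<le> r" using chain[OF q r] q r by blast
        have "m (x + y) \<le> s (x + y)" using s by (intro le)
        also have "\<dots> \<le> s x + s y" using C(2) s by (intro sublinear_add)
        also have "\<dots> \<le> q x + r y" using s by (intro add_mono) (auto simp: le_fun_def)
        finally show "m (x + y) - r y \<le> q x" by simp
      qed
      then show "m (x + y) - m x \<le> r y" by simp
    qed
    then show "m (x + y) \<le> m x + m y" by simp
  next
    fix t :: real and x assume t: "0 < t"
    have "m (t *\<^sub>R x) / t \<le> m x"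
    proof (rule ge)
      fix q assume q: "q \<in> C"
      show "m (t *\<^sub>R x) / t \<le> q x"
        using le[OF q, of "t *\<^sub>R x"] sublinear_scale[OF C(2)[OF q], of t x] t by (simp add: field_simps)
    qed
    then show "m (t *\<^sub>R x) \<le> t * m x" using t by (simp add: field_simps)
  next
    obtain q where "q \<in> C" using C(1) by blast
    then have "m 0 \<le> 0" using le[of q 0] sublinear_0[OF C(2)[of q]] by simp
    moreover have "0 \<le> m 0" by (rule ge) (simp add: sublinear_0[OF C(2)])
    ultimately show "m 0 = 0" by simp
  qed
  then show ?thesis using le by (auto simp: le_fun_def)
qed

text \<open>
By Zorn's lemma there is a minimal sublinear functional below \<open>p\<close>.  Minimality makes it odd
(\<open>sublinear_directional\<close>), and an odd sublinear functional is linear.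
\<close>

lemma sublinear_dominates_linear:
  assumes "sublinear p"
  shows "\<exists>f. linear f \<and> f \<le> p"
proof -
  let ?A = "{q. sublinear q \<and> q \<le> p}"
  let ?P = "\<lambda>q r. r \<le> q"
  have "partial_order_on ?A (relation_of ?P ?A)"
    by (rule partial_order_on_relation_ofI) auto
  then have "\<exists>m\<in>?A. \<forall>a\<in>?A. a \<le> m \<longrightarrow> a = m"
  proof (rule predicate_Zorn)
    fix C assume "C \<in> Chains (relation_of ?P ?A)"
    then have C: "C \<subseteq> ?A" and chain: "\<And>q r. q \<in> C \<Longrightarrow> r \<in> C \<Longrightarrow> q \<le> r \<or> r \<le> q"
      unfolding Chains_def relation_of_def by auto
    show "\<exists>u\<in>?A. \<forall>a\<in>C. u \<le> a"
    proof (cases "C = {}")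
      case True
      then show ?thesis using assms by auto
    next
      case False
      then obtain m where "sublinear m" "\<forall>q\<in>C. m \<le> q"
        using sublinear_Inf_chain[OF False, of p] C chain by blast
      moreover then have "m \<le> p" using False C by (blast intro: order_trans)
      ultimately show ?thesis by blast
    qed
  qed
  then obtain m where m: "sublinear m" "m \<le> p" and min: "\<And>r. sublinear r \<Longrightarrow> r \<le> m \<Longrightarrow> r = m"
    by (blast intro: order_trans)
  have minus: "m (- a) = - m a" for a
  proof -
    obtain r where "sublinear r" "r \<le> m" "r (- a) \<le> - m a"
      using sublinear_directional[OF m(1)] by blast
    then show ?thesis using min[of r] sublinear_minus[OF m(1), of a] by simp
  qed
  have "linear m"
  proof (rule linearI)
    fix x y
    show "m (x + y) = m x + m y"
      using sublinear_add[OF m(1), of x y] sublinear_add[OF m(1), of "- x" "- y"] minus[of x]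
        minus[of y] minus[of "x + y"] by simp
  next
    fix t x
    show "m (t *\<^sub>R x) = t *\<^sub>R m x"
      using sublinear_scale[OF m(1), of t x] sublinear_scale[OF m(1), of "- t" x] minus[of "t *\<^sub>R x"]
      by (cases "0 \<le> t") auto
  qed
  then show ?thesis using m by blast
qed

theorem hahn_banach_support:
  assumes "sublinear p"
  shows "\<exists>f. linear f \<and> f \<le> p \<and> f a = p a"
proof -
  obtain r where r: "sublinear r" "r \<le> p" "r (- a) \<le> - p a"
    using sublinear_directional[OF assms] by blast
  obtain f where f: "linear f" "f \<le> r" using sublinear_dominates_linear[OF r(1)] by blast
  have "- f a \<le> - p a"
    using le_funD[OF f(2), of "- a"] r(3) linear_neg[OF f(1), of a] by simp
  moreover have "f \<le> p" using f r by order
  ultimately show ?thesis using f(1) le_funD[of f p a] by (intro exI[of _ f]) auto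
qed

definition minkowski_gauge :: "'a::real_vector set \<Rightarrow> 'a \<Rightarrow> real" where
  "minkowski_gauge V x = Inf {t. 0 < t \<and> (1/t) *\<^sub>R x \<in> V}"

lemma minkowski_gauge_le: "0 < t \<Longrightarrow> (1/t) *\<^sub>R x \<in> V \<Longrightarrow> minkowski_gauge V x \<le> t"
  unfolding minkowski_gauge_def by (intro cInf_lower bdd_belowI[of _ 0]) auto

lemma absorbing_nbhd:
  fixes V :: "'a::frechet_space set"
  assumes "open V" "0 \<in> V"
  shows "\<exists>t>0. (1/t) *\<^sub>R x \<in> V"
proof -
  have "open ((\<lambda>s::real. s *\<^sub>R x) -` V)" by (intro open_vimage assms continuous_intros)
  moreover have "0 \<in> (\<lambda>s::real. s *\<^sub>R x) -` V" using assms by simp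
  ultimately obtain e where "e > 0" "ball 0 e \<subseteq> (\<lambda>s::real. s *\<^sub>R x) -` V"
    by (rule openE)
  moreover have "e / 2 \<in> ball 0 e" using \<open>e > 0\<close> by simp
  ultimately have "(e / 2) *\<^sub>R x \<in> V" by blast
  then show ?thesis using \<open>e > 0\<close> by (intro exI[of _ "2 / e"]) auto
qed

lemma sublinear_minkowski_gauge:
  fixes V :: "'a::frechet_space set"
  assumes "open V" "0 \<in> V" "convex V"
  shows "sublinear (minkowski_gauge V)"
proof (rule sublinearI)
  have ge: "c \<le> minkowski_gauge V x" if "\<And>t. 0 < t \<Longrightarrow> (1/t) *\<^sub>R x \<in> V \<Longrightarrow> c \<le> t" for c x
    unfolding minkowski_gauge_def using that absorbing_nbhd[OF assms(1,2), of x] by (intro cInf_greatest) auto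
  fix x y
  have "minkowski_gauge V (x + y) - minkowski_gauge V x \<le> minkowski_gauge V y"
  proof (rule ge)
    fix t :: real assume t: "0 < t" "(1/t) *\<^sub>R y \<in> V"
    have "minkowski_gauge V (x + y) - t \<le> minkowski_gauge V x"
    proof (rule ge)
      fix s :: real assume s: "0 < s" "(1/s) *\<^sub>R x \<in> V"
      have "(s / (s + t)) *\<^sub>R ((1/s) *\<^sub>R x) + (t / (s + t)) *\<^sub>R ((1/t) *\<^sub>R y) \<in> V"
        using s t by (intro convexD[OF assms(3)]) (simp_all add: add_divide_distrib[symmetric])
      then have "(1 / (s + t)) *\<^sub>R (x + y) \<in> V" using s t by (simp add: scaleR_right_distrib)
      then have "minkowski_gauge V (x + y) \<le> s + t" using s t by (intro minkowski_gauge_le) auto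
      then show "minkowski_gauge V (x + y) - t \<le> s" by simp
    qed
    then show "minkowski_gauge V (x + y) - minkowski_gauge V x \<le> t" by simp
  qed
  then show "minkowski_gauge V (x + y) \<le> minkowski_gauge V x + minkowski_gauge V y" by simp
next
  have ge: "c \<le> minkowski_gauge V x" if "\<And>t. 0 < t \<Longrightarrow> (1/t) *\<^sub>R x \<in> V \<Longrightarrow> c \<le> t" for c x
    unfolding minkowski_gauge_def using that absorbing_nbhd[OF assms(1,2), of x] by (intro cInf_greatest) auto
  show "minkowski_gauge V (s *\<^sub>R x) \<le> s * minkowski_gauge V x" if s: "0 < s" for s x
  proof -
    have "minkowski_gauge V (s *\<^sub>R x) / s \<le> minkowski_gauge V x"
    proof (rule ge)
      fix t :: real assume t: "0 < t" "(1/t) *\<^sub>R x \<in> V"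
      then have "minkowski_gauge V (s *\<^sub>R x) \<le> s * t" using s by (intro minkowski_gauge_le) auto
      then show "minkowski_gauge V (s *\<^sub>R x) / s \<le> t" using s by (simp add: field_simps)
    qed
    then show ?thesis using s by (simp add: field_simps)
  qed
  have "0 \<le> minkowski_gauge V 0" by (rule ge) simp
  moreover have "minkowski_gauge V 0 \<le> 0" by (rule field_le_epsilon) (use minkowski_gauge_le[of _ 0 V] assms(2) in auto)
  ultimately show "minkowski_gauge V 0 = 0" by simp
qed

lemma minkowski_gauge_ge_1:
  fixes V :: "'a::frechet_space set"
  assumes "open V" "0 \<in> V" "convex V" "x \<notin> V"
  shows "1 \<le> minkowski_gauge V x"
  unfolding minkowski_gauge_def
proof (rule cInf_greatest)
  fix t assume t: "t \<in> {t. 0 < t \<and> (1/t) *\<^sub>R x \<in> V}"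
  show "1 \<le> t"
  proof (rule ccontr)
    assume "\<not> 1 \<le> t"
    then have "t *\<^sub>R ((1/t) *\<^sub>R x) + (1 - t) *\<^sub>R 0 \<in> V"
      using t assms by (intro convexD[OF assms(3)]) auto
    then show False using t assms(4) by simp
  qed
qed (use absorbing_nbhd[OF assms(1,2), of x] in auto)

lemma continuous_linear_functional:
  fixes f :: "'a::frechet_space \<Rightarrow> real"
  assumes "linear f" "open V" "0 \<in> V" "\<And>y. y \<in> V \<Longrightarrow> f y \<le> 1"
  shows "continuous_on UNIV f"
  unfolding continuous_on_def
proof (intro ballI tendstoI)
  fix z and e :: real assume "e > 0"
  let ?W = "(\<lambda>y. (2/e) *\<^sub>R (y - z)) -` V \<inter> (\<lambda>y. (2/e) *\<^sub>R (z - y)) -` V"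
  have "open ?W" by (intro open_Int open_vimage assms continuous_intros)
  moreover have "z \<in> ?W" using assms by simp
  moreover have "dist (f y) (f z) < e" if "y \<in> ?W" for y
  proof -
    have "f ((2/e) *\<^sub>R (y - z)) \<le> 1" "f ((2/e) *\<^sub>R (z - y)) \<le> 1" using that assms(4) by auto
    then have "2 / e * (f y - f z) \<le> 1" "2 / e * (f z - f y) \<le> 1"
      using assms(1) by (simp_all add: linear_scale linear_diff diff_divide_distrib right_diff_distrib)
    then show ?thesis using \<open>e > 0\<close> by (auto simp: dist_real_def field_simps)
  qed
  ultimately show "\<forall>\<^sub>F y in at z within UNIV. dist (f y) (f z) < e"
    unfolding eventually_at_topological by blast
qed

text \<open>
A convex neighbourhood \<open>V\<close> of the origin that misses \<open>x\<close> has a Minkowski gauge of at least 1 at \<open>x\<close>;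
a linear functional supporting the gauge at \<open>x\<close> is bounded above on \<open>V\<close> and hence continuous.
\<close>

theorem separating_functional:
  fixes x :: "'a::frechet_space"
  assumes "x \<noteq> 0"
  shows "\<exists>l. linear l \<and> continuous_on UNIV l \<and> l x \<noteq> (0::real)"
proof -
  have "open (- {x})" "0 \<in> - {x}" using assms by auto
  then obtain V where V: "open V" "0 \<in> V" "V \<subseteq> - {x}" "convex V" by (rule convex_nbhd)
  obtain l where l: "linear l" "l \<le> minkowski_gauge V" "l x = minkowski_gauge V x"
    using hahn_banach_support[OF sublinear_minkowski_gauge[OF V(1,2,4)]] by blast
  have "continuous_on UNIV l"
  proof (rule continuous_linear_functional[OF l(1) V(1,2)])
    fix y assume "y \<in> V"
    then have "minkowski_gauge V y \<le> 1" by (intro minkowski_gauge_le) auto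
    then show "l y \<le> 1" using le_funD[OF l(2), of y] by simp
  qed
  moreover have "l x \<ge> 1" using minkowski_gauge_ge_1[OF V(1,2,4), of x] V(3) l(3) by auto
  ultimately show ?thesis using l(1) by (intro exI[of _ l]) auto
qed

text \<open>
Outside each ball around the origin the set \<open>K\<close> is compact, and there finitely many functionals
suffice; the balls of radius \<open>1 / (n + 1)\<close> exhaust the complement of the origin.
\<close>

lemma countable_separating_functionals:
  fixes K :: "'a::frechet_space set"
  assumes "compact K"
  obtains L :: "('a \<Rightarrow> real) set" where "countable L" "\<And>l. l \<in> L \<Longrightarrow> linear l"
    "\<And>l. l \<in> L \<Longrightarrow> continuous_on UNIV l" "\<And>x. x \<in> K \<Longrightarrow> x \<noteq> 0 \<Longrightarrow> \<exists>l\<in>L. l x \<noteq> 0"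
proof -
  obtain d :: "'a \<Rightarrow> 'a \<Rightarrow> real" where d: "Metric_space UNIV d"
    "Metric_space.mtopology UNIV d = euclidean" by (rule frechet_metric)
  interpret Metric_space UNIV d by fact
  define U where "U n = mball 0 (1 / real (Suc n))" for n
  let ?D = "{l :: 'a \<Rightarrow> real. linear l \<and> continuous_on UNIV l}"
  have "open (U n)" for n
    using openin_mball[of 0 "1 / real (Suc n)"] by (simp add: d(2) U_def flip: open_openin)
  have "\<exists>F. finite F \<and> F \<subseteq> ?D \<and> (\<forall>x\<in>K - U n. \<exists>l\<in>F. l x \<noteq> 0)" for n
  proof -
    have c: "compact (K - U n)" using assms \<open>open (U n)\<close> by (rule compact_diff)
    have o: "open {x. l x \<noteq> 0}" if "l \<in> ?D" for l
      using that by (intro open_Collect_neq continuous_on_const) auto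
    have cov: "K - U n \<subseteq> (\<Union>l\<in>?D. {x. l x \<noteq> 0})"
    proof
      fix x assume "x \<in> K - U n"
      then have "x \<noteq> 0" by (auto simp: U_def)
      then show "x \<in> (\<Union>l\<in>?D. {x. l x \<noteq> 0})" using separating_functional[of x] by auto
    qed
    obtain F where "F \<subseteq> ?D" "finite F" "K - U n \<subseteq> (\<Union>l\<in>F. {x. l x \<noteq> 0})"
      by (rule compactE_image[OF c o cov])
    then show ?thesis by (intro exI[of _ F] conjI) auto
  qed
  then have "\<forall>n. \<exists>F. finite F \<and> F \<subseteq> ?D \<and> (\<forall>x\<in>K - U n. \<exists>l\<in>F. l x \<noteq> 0)" ..
  from choice[OF this] obtain F where
    "\<forall>n. finite (F n) \<and> F n \<subseteq> ?D \<and> (\<forall>x\<in>K - U n. \<exists>l\<in>F n. l x \<noteq> 0)" ..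
  then have F: "finite (F n)" "F n \<subseteq> ?D" "x \<in> K - U n \<Longrightarrow> \<exists>l\<in>F n. l x \<noteq> 0" for n x
    by simp_all
  show thesis
  proof (rule that[of "\<Union>n. F n"])
    show "countable (\<Union>n. F n)" using F(1) by (auto intro: countable_finite)
    fix x assume "x \<in> K" "x \<noteq> 0"
    then have "d 0 x > 0" by simp
    then obtain n where "1 / real (Suc n) < d 0 x" using nat_approx_posE by blast
    then have "x \<in> K - U n" using \<open>x \<in> K\<close> by (auto simp: U_def)
    from F(3)[OF this] show "\<exists>l\<in>\<Union>n. F n. l x \<noteq> 0" by auto
  qed (use F(2) in auto)
qed

section \<open>Compact convex sets with positive integrals\<close>

lemma convex_closure_frechet:
  fixes S :: "'a::frechet_space set"
  assumes "convex S" shows "convex (closure S)"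
  unfolding convex_alt
proof (intro ballI allI impI)
  fix x y and t :: real assume x: "x \<in> closure S" "y \<in> closure S" and t: "0 \<le> t \<and> t \<le> 1"
  let ?f = "\<lambda>p. (1 - t) *\<^sub>R fst p + t *\<^sub>R snd p"
  have "?f ` closure (S \<times> S) \<subseteq> closure S"
  proof (rule image_closure_subset)
    show "continuous_on (closure (S \<times> S)) ?f" by (intro continuous_intros)
    show "?f ` (S \<times> S) \<subseteq> closure S"
      using assms t closure_subset[of S] by (auto simp: convex_alt)
  qed simp
  moreover have "(x, y) \<in> closure (S \<times> S)" using x by (simp add: closure_Times)
  ultimately have "?f (x, y) \<in> closure S" by blast
  then show "(1 - t) *\<^sub>R x + t *\<^sub>R y \<in> closure S" by simp
qed

text \<open>
The set \<open>D\<close> is the difference set \<open>B - B\<close>, where \<open>B\<close> is the closed convex hull of \<open>C\<close> and the origin.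
\<close>

lemma compact_disc_hull:
  fixes C :: "'a::frechet_space set"
  assumes "compact C"
  obtains D where "compact D" "convex D" "C \<subseteq> D" "0 \<in> D" "\<And>x. x \<in> D \<Longrightarrow> - x \<in> D"
proof -
  let ?B = "closure (convex hull (insert 0 C))"
  let ?D = "\<Union>x\<in>?B. \<Union>y\<in>?B. {x - y}"
  have sub: "insert 0 C \<subseteq> ?B" using closure_subset hull_subset by (rule order_trans[rotated])
  have B: "compact ?B" "convex ?B"
    using compact_closure_convex_hull[of "insert 0 C"] convex_closure_frechet[OF convex_convex_hull] assms
    by (auto simp: compact_insert)
  have "?D = (\<lambda>p. fst p - snd p) ` (?B \<times> ?B)" by (force simp: image_iff)
  moreover have "compact \<dots>"
    by (intro compact_continuous_image compact_Times B continuous_intros)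
  ultimately have "compact ?D" by simp
  moreover have "convex ?D" by (intro convex_differences B)
  moreover have "C \<subseteq> ?D"
  proof
    fix x assume "x \<in> C"
    then have "x \<in> ?B" "0 \<in> ?B" "x = x - 0" using sub by auto
    then show "x \<in> ?D" by blast
  qed
  moreover have "0 \<in> ?D"
  proof -
    have "0 \<in> ?B" "0 = 0 - (0::'a)" using sub by auto
    then show ?thesis by blast
  qed
  moreover have "- x \<in> ?D" if "x \<in> ?D" for x using that by force
  ultimately show thesis by (rule that)
qed

lemma scaleR_in_multiple_of_disc:
  assumes "convex D" "0 \<in> D" "\<And>x. x \<in> D \<Longrightarrow> - x \<in> D" "x \<in> D" "\<bar>s\<bar> \<le> m"
  shows "s *\<^sub>R x \<in> (\<lambda>x. m *\<^sub>R x) ` D"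
proof (cases "m = 0")
  case True
  then show ?thesis using assms by auto
next
  case False
  then have m: "0 < m" using assms(5) by simp
  define y where "y = (if 0 \<le> s then x else - x)"
  have "y \<in> D" using assms by (auto simp: y_def)
  then have "(\<bar>s\<bar> / m) *\<^sub>R y + (1 - \<bar>s\<bar> / m) *\<^sub>R 0 \<in> D"
    using assms m by (intro convexD[OF assms(1)]) (auto simp: field_simps)
  moreover have "s *\<^sub>R x = m *\<^sub>R ((\<bar>s\<bar> / m) *\<^sub>R y + (1 - \<bar>s\<bar> / m) *\<^sub>R 0)"
    using m by (auto simp: y_def)
  ultimately show ?thesis by blast
qed

lemma subspace_Union_multiples:
  assumes D: "convex D" "0 \<in> D" "\<And>x. x \<in> D \<Longrightarrow> - x \<in> D"
  shows "subspace (\<Union>n::nat. (\<lambda>x. real n *\<^sub>R x) ` D)"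
  unfolding subspace_def
proof (intro conjI ballI allI)
  let ?S = "\<Union>n::nat. (\<lambda>x. real n *\<^sub>R x) ` D"
  show "0 \<in> ?S" using D(2) by force
  fix x assume "x \<in> ?S"
  then obtain n a where x: "x = real n *\<^sub>R a" "a \<in> D" by auto
  show "c *\<^sub>R x \<in> ?S" for c
  proof -
    obtain m :: nat where "\<bar>c * real n\<bar> \<le> real m" using real_arch_simple by blast
    then have "(c * real n) *\<^sub>R a \<in> (\<lambda>x. real m *\<^sub>R x) ` D" by (intro scaleR_in_multiple_of_disc D x)
    then show ?thesis using x by auto
  qed
  fix y assume "y \<in> ?S"
  then obtain m b where y: "y = real m *\<^sub>R b" "b \<in> D" by auto
  show "x + y \<in> ?S"
  proof (cases "n + m = 0")
    case True
    then show ?thesis using x y \<open>0 \<in> ?S\<close> by auto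
  next
    case False
    let ?z = "(real n / real (n + m)) *\<^sub>R a + (real m / real (n + m)) *\<^sub>R b"
    have "?z \<in> D"
      using False x y by (intro convexD[OF D(1)]) (auto simp flip: add_divide_distrib)
    moreover have "x + y = real (n + m) *\<^sub>R ?z"
      using False x y by (simp add: scaleR_add_right del: of_nat_add)
    ultimately show ?thesis by blast
  qed
qed

lemma zero_one_borel:
  assumes "zero_one_law M" "borel_measure M" "affine A" "A \<in> sets borel"
  shows "emeasure M A = 0 \<or> emeasure M A = 1"
proof -
  have "A \<in> sets M" using assms(2,4) by (simp add: borel_measure_def)
  then have "A \<in> sets (completion M)" "emeasure (completion M) A = emeasure M A" by simp_all
  then show ?thesis using assms(1)[unfolded zero_one_law_def, rule_format, of A] assms(3) by simp
qed

text \<open>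
The multiples of a symmetric compact convex set containing \<open>C\<close> fill up a Borel subspace; it has
positive measure because of \<open>C\<close>, so it has measure 1 by the zero-one law.
\<close>

lemma exhausting_compact_convex:
  fixes \<mu> :: "'a::frechet_space measure"
  assumes "borel_measure \<mu>" "zero_one_law \<mu>" "compact C" "0 < emeasure \<mu> C"
  obtains D :: "nat \<Rightarrow> 'a set" where "\<And>n. compact (D n)" "\<And>n. convex (D n)" "incseq D"
    "emeasure \<mu> (\<Union>n. D n) = 1"
proof -
  obtain B where B: "compact B" "convex B" "C \<subseteq> B" "0 \<in> B" "\<And>x. x \<in> B \<Longrightarrow> - x \<in> B"
    by (rule compact_disc_hull[OF assms(3)]) blast
  define D where "D n = (\<lambda>x. real n *\<^sub>R x) ` B" for n :: nat
  have D: "compact (D n)" "convex (D n)" for n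
    unfolding D_def using B by (auto intro!: compact_continuous_image continuous_intros convex_scaling)
  have borel: "D n \<in> sets borel" for n
    using D(1)[of n] by (intro borel_closed compact_imp_closed)
  have "incseq D"
  proof (rule incseq_SucI)
    fix n
    have "real n *\<^sub>R x \<in> (\<lambda>x. real (Suc n) *\<^sub>R x) ` B" if "x \<in> B" for x
      by (intro scaleR_in_multiple_of_disc B that) auto
    then show "D n \<subseteq> D (Suc n)" unfolding D_def by blast
  qed
  have "C \<subseteq> D 1" using B(3) by (auto simp: D_def)
  also have "\<dots> \<subseteq> (\<Union>n. D n)" by blast
  finally have "emeasure \<mu> C \<le> emeasure \<mu> (\<Union>n. D n)"
    using assms(1) borel by (intro emeasure_mono) (auto simp: borel_measure_def)
  moreover have "affine (\<Union>n. D n)"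
    unfolding D_def by (intro subspace_imp_affine subspace_Union_multiples B)
  ultimately have "emeasure \<mu> (\<Union>n. D n) = 1"
    using zero_one_borel[OF assms(2,1), of "\<Union>n. D n"] borel assms(4) by auto
  with D \<open>incseq D\<close> show thesis using that by blast
qed

lemma set_integral_exhaustion:
  fixes f :: "'a \<Rightarrow> real"
  assumes f: "integrable M f" and A: "\<And>n. A n \<in> sets M" "incseq A" "AE x in M. x \<in> (\<Union>n. A n)"
  shows "(\<lambda>n. LINT x:A n|M. f x) \<longlonglongrightarrow> integral\<^sup>L M f"
  unfolding set_lebesgue_integral_def
proof (rule integral_dominated_convergence[where w = "\<lambda>x. \<bar>f x\<bar>"])
  have [measurable]: "f \<in> borel_measurable M" "\<And>n. A n \<in> sets M" using f A by auto
  show "f \<in> borel_measurable M" "\<And>n. (\<lambda>x. indicator (A n) x *\<^sub>R f x) \<in> borel_measurable M"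
    by measurable
  show "integrable M (\<lambda>x. \<bar>f x\<bar>)" using f by simp
  show "AE x in M. norm (indicator (A n) x *\<^sub>R f x) \<le> \<bar>f x\<bar>" for n
    by (intro AE_I2) (auto simp: indicator_def)
  show "AE x in M. (\<lambda>n. indicator (A n) x *\<^sub>R f x) \<longlonglongrightarrow> f x"
    using A(3)
  proof eventually_elim
    fix x assume "x \<in> (\<Union>n. A n)"
    then obtain m where "x \<in> A m" by blast
    then have "\<forall>\<^sub>F n in sequentially. indicator (A n) x *\<^sub>R f x = f x"
      using A(2) by (auto simp: eventually_sequentially incseq_def indicator_def intro!: exI[of _ m])
    then show "(\<lambda>n. indicator (A n) x *\<^sub>R f x) \<longlonglongrightarrow> f x" by (rule tendsto_eventually)
  qed
qed

lemma compact_convex_with_positive_integrals: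
  fixes \<mu> :: "'a::frechet_space measure" and u v :: "'a \<Rightarrow> real"
  assumes "prob_space \<mu>" "borel_measure \<mu>" "zero_one_law \<mu>" "compact C" "0 < emeasure \<mu> C"
    "integrable \<mu> u" "integrable \<mu> v" "0 < integral\<^sup>L \<mu> u" "0 < integral\<^sup>L \<mu> v"
    "convex F" "supported_on \<mu> F"
  obtains K where "compact K" "convex K" "K \<subseteq> F" "0 < (LINT x:K|\<mu>. u x)" "0 < (LINT x:K|\<mu>. v x)"
proof -
  interpret prob_space \<mu> by fact
  obtain D :: "nat \<Rightarrow> 'a set" where D: "\<And>n. compact (D n)" "\<And>n. convex (D n)" "incseq D"
    "emeasure \<mu> (\<Union>n. D n) = 1"
    by (rule exhausting_compact_convex[OF assms(2-5)]) blast
  have F: "closed F" "emeasure \<mu> (- F) = 0" using assms(11) by (auto simp: supported_on_def)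
  have sets: "sets \<mu> = sets borel" using assms(2) by (simp add: borel_measure_def)
  have space: "space \<mu> = UNIV" using sets_eq_imp_space_eq[OF sets] by simp
  have [measurable]: "D n \<in> sets \<mu>" "F \<in> sets \<mu>" for n
    using D(1)[of n] F(1) by (auto simp: sets compact_imp_closed)
  have "AE x in \<mu>. x \<in> (\<Union>n. D n)"
    using D(4) by (intro AE_prob_1) (simp add: measure_def)
  moreover have "AE x in \<mu>. x \<in> F"
    using F by (intro AE_I[of _ _ "- F"]) (auto simp: space sets)
  ultimately have ae: "AE x in \<mu>. x \<in> (\<Union>n. D n \<inter> F)" by eventually_elim auto
  have inc: "incseq (\<lambda>n. D n \<inter> F)" using D(3) by (auto simp: incseq_def)
  have lim: "(\<lambda>n. LINT x:D n \<inter> F|\<mu>. f x) \<longlonglongrightarrow> integral\<^sup>L \<mu> f" if "integrable \<mu> f" for f :: "'a \<Rightarrow> real"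
    by (intro set_integral_exhaustion that ae inc) simp
  have "\<forall>\<^sub>F n in sequentially. 0 < (LINT x:D n \<inter> F|\<mu>. u x) \<and> 0 < (LINT x:D n \<inter> F|\<mu>. v x)"
    using order_tendstoD(1)[OF lim[OF assms(6)] assms(8)] order_tendstoD(1)[OF lim[OF assms(7)] assms(9)]
    by (rule eventually_conj)
  then obtain n where "0 < (LINT x:D n \<inter> F|\<mu>. u x)" "0 < (LINT x:D n \<inter> F|\<mu>. v x)"
    using eventually_happens by fastforce
  then show thesis
    using that[of "D n \<inter> F"] D F assms(10) by (auto simp: compact_Int_closed convex_Int)
qed

section \<open>Continuous minorants of lower semicontinuous functions\<close>

lemma lower_semicontinuous_bounded_below:
  assumes "lower_semicontinuous u" "compact K"
  obtains c where "\<And>x. x \<in> K \<Longrightarrow> c \<le> u x"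
proof -
  have o: "open {x. - real n < u x}" for n using assms(1) by (simp add: lower_semicontinuous_def)
  have cov: "K \<subseteq> (\<Union>n\<in>UNIV. {x. - real n < u x})"
  proof
    fix x
    obtain n where "- u x < real n" using reals_Archimedean2 by blast
    then show "x \<in> (\<Union>n\<in>UNIV. {x. - real n < u x})" by (auto intro!: exI[of _ n])
  qed
  obtain N where N: "finite N" "K \<subseteq> (\<Union>n\<in>N. {x. - real n < u x})"
    by (rule compactE_image[OF assms(2) o cov])
  show thesis
  proof (rule that[of "- real (Max (insert 0 N))"])
    fix x assume "x \<in> K"
    then obtain n where "n \<in> N" "- real n < u x" using N by blast
    moreover then have "n \<le> Max (insert 0 N)" using N by (intro Max_ge) auto
    ultimately show "- real (Max (insert 0 N)) \<le> u x" by linarith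
  qed
qed

text \<open>
The functions are truncated inf-convolutions of \<open>u\<close> with the multiples of the metric.  They
are Lipschitz, lie below \<open>u\<close> on \<open>K\<close>, and approach \<open>u\<close> because distant points are
penalized ever more while nearby values of \<open>u\<close> are almost as large as \<open>u x\<close>.
\<close>

lemma lower_semicontinuous_regularization:
  fixes u :: "'a::frechet_space \<Rightarrow> real"
  assumes "lower_semicontinuous u" "compact K" "K \<noteq> {}"
  obtains f :: "nat \<Rightarrow> 'a \<Rightarrow> real" and c where "\<And>n. continuous_on UNIV (f n)" "\<And>n. bounded (range (f n))"
    "\<And>n x. x \<in> K \<Longrightarrow> f n x \<le> u x" "\<And>n x. c \<le> f n x" "\<And>x. x \<in> K \<Longrightarrow> (\<lambda>n. f n x) \<longlonglongrightarrow> u x"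
proof -
  obtain d :: "'a \<Rightarrow> 'a \<Rightarrow> real" where d: "Metric_space UNIV d"
    "Metric_space.mtopology UNIV d = euclidean" by (rule frechet_metric)
  interpret Metric_space UNIV d by fact
  have ball: "open (mball x e)" for x e
    using openin_mball[of x e] by (simp add: d(2) flip: open_openin)
  obtain c where c: "\<And>x. x \<in> K \<Longrightarrow> c \<le> u x"
    by (rule lower_semicontinuous_bounded_below[OF assms(1,2)]) blast
  define g where "g n x = (INF y\<in>K. u y + real n * d x y)" for n x
  define f where "f n x = min (real n) (g n x)" for n x
  have bdd: "bdd_below ((\<lambda>y. u y + real n * d x y) ` K)" for n x
    using c by (intro bdd_belowI2[of _ c]) (simp add: add_increasing2)
  have le: "g n x \<le> u y + real n * d x y" if "y \<in> K" for n x y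
    unfolding g_def using that by (intro cINF_lower bdd)
  have ge: "b \<le> g n x" if "\<And>y. y \<in> K \<Longrightarrow> b \<le> u y + real n * d x y" for n x b
    unfolding g_def using that assms(3) by (intro cINF_greatest)
  have gc: "c \<le> g n x" for n x
    using c by (intro ge) (simp add: add_increasing2)
  have lip: "g n x \<le> g n x' + real n * d x x'" for n x x'
  proof -
    have "g n x - real n * d x x' \<le> g n x'"
    proof (rule ge)
      fix y assume "y \<in> K"
      have "real n * d x y \<le> real n * (d x x' + d x' y)"
        by (intro mult_left_mono triangle) auto
      then show "g n x - real n * d x x' \<le> u y + real n * d x' y"
        using le[OF \<open>y \<in> K\<close>, of n x] by (simp add: algebra_simps)
    qed
    then show ?thesis by simp
  qed
  have "continuous_on UNIV (g n)" for n
    unfolding continuous_on_def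
  proof (intro ballI tendstoI)
    fix x and e :: real assume e: "e > 0"
    have "x \<in> mball x (e / real (Suc n))" using e by simp
    moreover have "dist (g n y) (g n x) < e" if y: "y \<in> mball x (e / real (Suc n))" for y
    proof -
      have "real n * d x y \<le> real (Suc n) * d x y" by (intro mult_right_mono) auto
      also have "\<dots> < e" using y by (simp add: field_simps)
      finally show ?thesis using lip[of n x y] lip[of n y x] commute[of x y]
        by (simp add: dist_real_def)
    qed
    ultimately show "\<forall>\<^sub>F y in at x within UNIV. dist (g n y) (g n x) < e"
      unfolding eventually_at_topological using ball by blast
  qed
  then have "continuous_on UNIV (f n)" for n
    unfolding f_def by (intro continuous_intros)
  moreover have "bounded (range (f n))" for n
  proof (rule boundedI)
    fix y assume "y \<in> range (f n)"
    then obtain x where y: "y = f n x" by blast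
    have "- \<bar>c\<bar> \<le> f n x" using gc[of n x] by (auto simp: f_def abs_if)
    moreover have "f n x \<le> real n" by (simp add: f_def)
    ultimately show "norm y \<le> real n + \<bar>c\<bar>" using y by simp
  qed
  moreover have fu: "f n x \<le> u x" if "x \<in> K" for n x
    using le[OF that, of n x] by (simp add: f_def min_le_iff_disj)
  moreover have "- \<bar>c\<bar> \<le> f n x" for n x using gc[of n x] by (auto simp: f_def abs_if)
  moreover have "(\<lambda>n. f n x) \<longlonglongrightarrow> u x" if x: "x \<in> K" for x
  proof (rule order_tendstoI)
    fix b assume "b < u x"
    then obtain b' where b': "b < b'" "b' < u x" using dense by blast
    have "open {y. b' < u y}" using assms(1) by (simp add: lower_semicontinuous_def)
    then have "openin mtopology {y. b' < u y}" by (simp add: d(2) flip: open_openin)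
    then obtain r where r: "r > 0" "mball x r \<subseteq> {y. b' < u y}"
      using b' unfolding openin_mtopology by blast
    \<comment> \<open>Beyond distance \<open>r\<close> the penalty \<open>N * r\<close> outweighs
      the gap between \<open>b'\<close> and the lower bound \<open>c\<close>; the
      other term of the maximum deals with the truncation.\<close>
    obtain N :: nat where N: "max b' ((b' - c) / r) < real N" using reals_Archimedean2 by blast
    have "b < f n x" if n: "N \<le> n" for n
    proof -
      have "real N \<le> real n" using n by simp
      have "b' \<le> g n x"
      proof (rule ge)
        fix y assume y: "y \<in> K"
        show "b' \<le> u y + real n * d x y"
        proof (cases "d x y < r")
          case True
          then have "b' < u y" using r by auto
          then show ?thesis by (simp add: add_increasing2)
        next
          case False
          have "b' - c \<le> real N * r" using N r by (simp add: field_simps)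
          also have "\<dots> \<le> real n * d x y" using False r \<open>real N \<le> real n\<close> by (intro mult_mono) auto
          finally show ?thesis using c[OF y] by simp
        qed
      qed
      then show ?thesis using b' N \<open>real N \<le> real n\<close> by (simp add: f_def)
    qed
    then show "\<forall>\<^sub>F n in sequentially. b < f n x" by (auto simp: eventually_sequentially)
  next
    fix b assume "u x < b"
    then show "\<forall>\<^sub>F n in sequentially. f n x < b"
      using fu[OF x] by (intro always_eventually allI) (rule order_le_less_trans)
  qed
  ultimately show thesis by (rule that)
qed

text \<open>
Dominated convergence for the regularizations: on \<open>K\<close> they lie between a constant and \<open>u\<close>.
\<close>

lemma continuous_minorant_with_positive_integral:
  fixes u :: "'a::frechet_space \<Rightarrow> real"
  assumes "prob_space \<mu>" "borel_measure \<mu>" "lower_semicontinuous u" "compact K" "integrable \<mu> u"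
    "0 < (LINT x:K|\<mu>. u x)"
  obtains f where "continuous_on UNIV f" "bounded (range f)" "\<And>x. x \<in> K \<Longrightarrow> f x \<le> u x"
    "0 < (LINT x:K|\<mu>. f x)"
proof -
  interpret prob_space \<mu> by fact
  have "K \<noteq> {}" using assms(6) by (auto simp: set_lebesgue_integral_def)
  obtain f :: "nat \<Rightarrow> 'a \<Rightarrow> real" and c where f: "\<And>n. continuous_on UNIV (f n)"
    "\<And>n. bounded (range (f n))" "\<And>n x. x \<in> K \<Longrightarrow> f n x \<le> u x" "\<And>n x. c \<le> f n x"
    "\<And>x. x \<in> K \<Longrightarrow> (\<lambda>n. f n x) \<longlonglongrightarrow> u x"
    by (rule lower_semicontinuous_regularization[OF assms(3,4) \<open>K \<noteq> {}\<close>]) blast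
  have sets: "sets \<mu> = sets borel" using assms(2) by (simp add: borel_measure_def)
  have [measurable]: "K \<in> sets \<mu>" "u \<in> borel_measurable \<mu>" "\<And>n. f n \<in> borel_measurable \<mu>"
    using assms(4,5) borel_measurable_continuous_onI[OF f(1)] 
    by (auto simp: sets compact_imp_closed measurable_cong_sets[OF sets refl])
  have "(\<lambda>n. LINT x:K|\<mu>. f n x) \<longlonglongrightarrow> (LINT x:K|\<mu>. u x)"
    unfolding set_lebesgue_integral_def
  proof (rule integral_dominated_convergence[where w = "\<lambda>x. \<bar>u x\<bar> + \<bar>c\<bar>"])
    show "integrable \<mu> (\<lambda>x. \<bar>u x\<bar> + \<bar>c\<bar>)" using assms(5) by simp
    show "AE x in \<mu>. (\<lambda>n. indicator K x *\<^sub>R f n x) \<longlonglongrightarrow> indicator K x *\<^sub>R u x"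
      using f(5) by (intro AE_I2) (auto simp: indicator_def)
    show "AE x in \<mu>. norm (indicator K x *\<^sub>R f n x) \<le> \<bar>u x\<bar> + \<bar>c\<bar>" for n
    proof (intro AE_I2)
      fix x
      show "norm (indicator K x *\<^sub>R f n x) \<le> \<bar>u x\<bar> + \<bar>c\<bar>"
        using f(3)[of x n] f(4)[of n x] by (cases "x \<in> K") auto
    qed
  qed measurable
  from order_tendstoD(1)[OF this assms(6)] obtain n where "0 < (LINT x:K|\<mu>. f n x)"
    using eventually_happens by fastforce
  then show thesis using f that by blast
qed

section \<open>Bisection by a hyperplane\<close>

lemma affine_form_combination:
  fixes h :: "'a::real_vector \<Rightarrow> real"
  assumes "linear l" "\<And>x. h x = l x + c" "u + v = 1"
  shows "h (u *\<^sub>R x + v *\<^sub>R y) = u * h x + v * h y"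
proof -
  have "c = u * c + v * c" using assms(3) by (simp flip: distrib_right)
  then show ?thesis using assms(1,2) by (simp add: linear_add linear_scale algebra_simps)
qed

lemma set_integral_Int_null:
  fixes f :: "'a \<Rightarrow> real"
  assumes [measurable]: "f \<in> borel_measurable M" "K \<in> sets M" "Z \<in> sets M"
    and Z: "AE x in M. x \<in> Z"
  shows "(LINT x:K \<inter> Z|M. f x) = (LINT x:K|M. f x)"
  unfolding set_lebesgue_integral_def
proof (rule integral_cong_AE)
  show "AE x in M. indicator (K \<inter> Z) x *\<^sub>R f x = indicator K x *\<^sub>R f x"
    using Z by eventually_elim (simp add: indicator_def)
qed measurable

text \<open>
A half-plane whose boundary line passes through \<open>(p, q)\<close> is rotated by half a turn.  Unless one of
the hyperplanes met on the way has full measure, the integral of \<open>f\<close> over the corresponding part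
of \<open>K\<close> changes continuously, and its initial and final values add up to the full integral; so
at some moment both parts carry exactly half of it.  At that moment at least one part has a
positive integral of \<open>g\<close>.
\<close>

lemma bisection:
  fixes \<mu> :: "'a::frechet_space measure" and f g l m :: "'a \<Rightarrow> real"
  assumes "prob_space \<mu>" "borel_measure \<mu>" "zero_one_law \<mu>" "compact K" "convex K"
    and f: "integrable \<mu> f" "0 < (LINT x:K|\<mu>. f x)" and g: "integrable \<mu> g" "0 < (LINT x:K|\<mu>. g x)"
    and l: "linear l" "continuous_on UNIV l" and m: "linear m" "continuous_on UNIV m"
  obtains K' \<alpha> \<beta> where "compact K'" "convex K'" "K' \<subseteq> K"
    "0 < (LINT x:K'|\<mu>. f x)" "0 < (LINT x:K'|\<mu>. g x)"
    "\<alpha> \<noteq> 0 \<or> \<beta> \<noteq> (0::real)" "\<And>x. x \<in> K' \<Longrightarrow> 0 \<le> \<alpha> * (l x - p) + \<beta> * (m x - q)"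
proof -
  note result = that
  interpret prob_space \<mu> by fact
  have sets: "sets \<mu> = sets borel" using assms(2) by (simp add: borel_measure_def)
  have space: "space \<mu> = UNIV" using sets_eq_imp_space_eq[OF sets] by simp
  \<comment> \<open>A polynomial substitute for the rotation: the coefficients never vanish
    simultaneously, and \<open>h 1\<close> is the negative of \<open>h 0\<close>.\<close>
  define h where "h t x = (1 - 2 * t) * (l x - p) + t * (1 - t) * (m x - q)" for t x
  have h_comb: "h t (u *\<^sub>R x + v *\<^sub>R y) = u * h t x + v * h t y" if "u + v = 1" for t u v x y
  proof (rule affine_form_combination[OF _ _ that])
    show "linear (\<lambda>x. (1 - 2 * t) * l x + t * (1 - t) * m x)"
      by (intro linearI) (simp_all add: linear_add[OF l(1)] linear_add[OF m(1)]
          linear_scale[OF l(1)] linear_scale[OF m(1)] algebra_simps)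
    show "h t x = (1 - 2 * t) * l x + t * (1 - t) * m x + (- (1 - 2 * t) * p - t * (1 - t) * q)" for x
      by (simp add: h_def algebra_simps)
  qed
  have h_cont: "continuous_on UNIV (h t)" for t
    unfolding h_def by (intro continuous_intros l m)
  define Z where "Z t = {x. h t x = 0}" for t
  define P where "P t = {x. 0 \<le> h t x}" for t
  define N where "N t = {x. h t x \<le> 0}" for t
  have closed: "closed (Z t)" "closed (P t)" "closed (N t)" for t
    unfolding Z_def P_def N_def
    by (intro closed_Collect_eq closed_Collect_le h_cont continuous_on_const)+
  have conv: "affine (Z t)" "convex (P t)" "convex (N t)" for t
    unfolding affine_def convex_def Z_def P_def N_def
    by (auto simp: h_comb intro!: add_nonneg_nonneg add_nonpos_nonpos mult_nonneg_nonneg mult_nonneg_nonpos)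
  have meas [measurable]: "Z t \<in> sets \<mu>" "P t \<in> sets \<mu>" "N t \<in> sets \<mu>" "K \<in> sets \<mu>" for t
    using closed[of t] assms(4) by (auto simp: sets compact_imp_closed)
  have [measurable]: "f \<in> borel_measurable \<mu>" "g \<in> borel_measurable \<mu>" using f g by auto
  have coeff: "1 - 2 * t \<noteq> 0 \<or> t * (1 - t) \<noteq> 0" for t :: real
    by (cases "t = 1/2") auto
  have found: thesis if t: "0 < (LINT x:K \<inter> C|\<mu>. f x)" "0 < (LINT x:K \<inter> C|\<mu>. g x)"
    and C: "closed C" "convex C" "C \<subseteq> P t \<or> C \<subseteq> N t" for C t
    using C(3)
  proof
    assume "C \<subseteq> P t"
    then show thesis
      using result[of "K \<inter> C" "1 - 2 * t" "t * (1 - t)"] t C coeff[of t] assms(4,5)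
      by (auto simp: compact_Int_closed convex_Int P_def h_def)
  next
    assume "C \<subseteq> N t"
    have "0 \<le> - (1 - 2 * t) * (l x - p) + (- (t * (1 - t))) * (m x - q)" if "x \<in> K \<inter> C" for x
    proof -
      have "h t x \<le> 0" using that \<open>C \<subseteq> N t\<close> by (auto simp: N_def)
      moreover have "- (1 - 2 * t) * (l x - p) + (- (t * (1 - t))) * (m x - q) = - h t x"
        by (simp add: h_def algebra_simps)
      ultimately show ?thesis by simp
    qed
    then show thesis
      using result[of "K \<inter> C" "- (1 - 2 * t)" "- (t * (1 - t))"] t C coeff[of t] assms(4,5)
      by (auto simp: compact_Int_closed convex_Int)
  qed
  show thesis
  proof (cases "\<exists>t. emeasure \<mu> (Z t) = 1")
    case True
    then obtain t where "emeasure \<mu> (Z t) = 1" by blast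
    then have "AE x in \<mu>. x \<in> Z t" by (intro AE_prob_1) (simp add: measure_def)
    then have "(LINT x:K \<inter> Z t|\<mu>. \<phi> x) = (LINT x:K|\<mu>. \<phi> x)"
      if "\<phi> \<in> borel_measurable \<mu>" for \<phi> :: "'a \<Rightarrow> real"
      using that by (intro set_integral_Int_null meas)
    then show thesis
      using f g closed[of t] conv[of t] by (intro found[of "Z t" t]) (auto simp: Z_def P_def affine_imp_convex)
  next
    case False
    then have "emeasure \<mu> (Z t) = 0" for t
      using zero_one_borel[OF assms(3,2) conv(1)] meas(1) unfolding sets by blast
    then have null: "AE x in \<mu>. h t x \<noteq> 0" for t
      using meas(1)[of t] by (intro AE_I[of _ _ "Z t"]) (auto simp: Z_def)
    have split: "(LINT x:K \<inter> P t|\<mu>. \<phi> x) + (LINT x:K \<inter> N t|\<mu>. \<phi> x) = (LINT x:K|\<mu>. \<phi> x)"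
      if \<phi>: "integrable \<mu> \<phi>" for \<phi> :: "'a \<Rightarrow> real" and t
    proof -
      have [measurable]: "\<phi> \<in> borel_measurable \<mu>" using \<phi> by auto
      have i: "integrable \<mu> (\<lambda>x. indicator A x *\<^sub>R \<phi> x)" if "A \<in> sets \<mu>" for A
        using \<phi> that by (rule integrable_mult_indicator[rotated])
      have "(LINT x:K \<inter> P t|\<mu>. \<phi> x) + (LINT x:K \<inter> N t|\<mu>. \<phi> x) =
          (\<integral>x. indicator (K \<inter> P t) x *\<^sub>R \<phi> x + indicator (K \<inter> N t) x *\<^sub>R \<phi> x \<partial>\<mu>)"
        unfolding set_lebesgue_integral_def by (intro Bochner_Integration.integral_add[symmetric] i) auto
      also have "\<dots> = (LINT x:K|\<mu>. \<phi> x)"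
        unfolding set_lebesgue_integral_def
      proof (rule integral_cong_AE)
        show "AE x in \<mu>. indicator (K \<inter> P t) x *\<^sub>R \<phi> x + indicator (K \<inter> N t) x *\<^sub>R \<phi> x
            = indicator K x *\<^sub>R \<phi> x"
          using null[of t] by eventually_elim (auto simp: indicator_def P_def N_def)
      qed measurable
      finally show ?thesis .
    qed
    let ?G = "\<lambda>t. LINT x:K \<inter> P t|\<mu>. f x"
    \<comment> \<open>The indicators converge at all points off the limiting hyperplane, that is,
      almost everywhere.\<close>
    have cont: "continuous_on {0..1} ?G"
      unfolding continuous_on_sequentially
    proof (intro allI ballI impI)
      fix s :: "nat \<Rightarrow> real" and t assume "(\<forall>n. s n \<in> {0..1}) \<and> s \<longlonglongrightarrow> t"
      then have s: "s \<longlonglongrightarrow> t" by simp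
      show "(?G \<circ> s) \<longlonglongrightarrow> ?G t"
        unfolding comp_def set_lebesgue_integral_def
      proof (rule integral_dominated_convergence[where w = "\<lambda>x. \<bar>f x\<bar>"])
        show "integrable \<mu> (\<lambda>x. \<bar>f x\<bar>)" using f by simp
        show "AE x in \<mu>. norm (indicator (K \<inter> P (s n)) x *\<^sub>R f x) \<le> \<bar>f x\<bar>" for n
          by (intro AE_I2) (auto simp: indicator_def)
        show "AE x in \<mu>. (\<lambda>n. indicator (K \<inter> P (s n)) x *\<^sub>R f x) \<longlonglongrightarrow> indicator (K \<inter> P t) x *\<^sub>R f x"
          using null[of t]
        proof eventually_elim
          case (elim x)
          have lim: "(\<lambda>n. h (s n) x) \<longlonglongrightarrow> h t x"
            unfolding h_def by (intro tendsto_intros s)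
          have "\<forall>\<^sub>F n in sequentially. (0 \<le> h (s n) x) = (0 \<le> h t x)"
          proof (cases "0 < h t x")
            case True
            from order_tendstoD(1)[OF lim this] show ?thesis by eventually_elim (use True in auto)
          next
            case False
            then have neg: "h t x < 0" using elim by simp
            from order_tendstoD(2)[OF lim this] show ?thesis by eventually_elim (use neg in auto)
          qed
          then have "\<forall>\<^sub>F n in sequentially. indicator (K \<inter> P (s n)) x *\<^sub>R f x = indicator (K \<inter> P t) x *\<^sub>R f x"
            by eventually_elim (auto simp: indicator_def P_def)
          then show ?case by (rule tendsto_eventually)
        qed
      qed measurable
    qed
    have "P 1 = N 0" by (auto simp: P_def N_def h_def)
    then have ends: "?G 0 + ?G 1 = (LINT x:K|\<mu>. f x)" using split[OF f(1), of 0] by simp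
    have "\<exists>t. 0 \<le> t \<and> t \<le> 1 \<and> ?G t = (LINT x:K|\<mu>. f x) / 2"
    proof (cases "?G 0 \<le> (LINT x:K|\<mu>. f x) / 2")
      case True
      then show ?thesis using ends by (intro IVT' cont) auto
    next
      case False
      then show ?thesis using ends by (intro IVT2' cont) auto
    qed
    then obtain t where t: "?G t = (LINT x:K|\<mu>. f x) / 2" by blast
    then have t': "(LINT x:K \<inter> N t|\<mu>. f x) = (LINT x:K|\<mu>. f x) / 2" using split[OF f(1), of t] by simp
    show thesis
    proof (cases "0 < (LINT x:K \<inter> P t|\<mu>. g x)")
      case True
      then show thesis using t f(2) closed[of t] conv[of t] by (intro found[of "P t" t]) auto
    next
      case False
      then have "0 < (LINT x:K \<inter> N t|\<mu>. g x)" using split[OF g(1), of t] g(2) by linarith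
      then show thesis using t' f(2) closed[of t] conv[of t] by (intro found[of "N t" t]) auto
    qed
  qed
qed

section \<open>Shrinking to a segment\<close>

lemma rational_point_in_triangle:
  fixes A1 A2 B1 B2 p0 q0 :: real
  assumes det: "A1 * B2 - B1 * A2 \<noteq> 0"
  obtains p q s t where "p \<in> \<rat>" "q \<in> \<rat>" "0 < s" "0 < t" "s + t < 1"
    "p = p0 + s * A1 + t * B1" "q = q0 + s * A2 + t * B2"
proof -
  \<comment> \<open>By Cramer's rule \<open>s z\<close> and \<open>t z\<close> are the coordinates
    of \<open>z\<close> with respect to the vertex \<open>(p0, q0)\<close> and the
    two edges; the centroid shows that the open triangle is not empty.\<close>
  define D where "D = A1 * B2 - B1 * A2"
  define s where "s z = ((fst z - p0) * B2 - (snd z - q0) * B1) / D" for z :: "real \<times> real"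
  define t where "t z = ((snd z - q0) * A1 - (fst z - p0) * A2) / D" for z :: "real \<times> real"
  have D: "D \<noteq> 0" using det by (simp add: D_def)
  let ?U = "{z. 0 < s z} \<inter> {z. 0 < t z} \<inter> {z. s z + t z < 1}"
  let ?c = "(p0 + (A1 + B1) / 3, q0 + (A2 + B2) / 3)"
  have "open ?U"
    unfolding s_def t_def using D by (intro open_Int open_Collect_less continuous_intros) auto
  moreover have "s ?c = 1/3" "t ?c = 1/3"
    using D by (simp_all add: s_def t_def field_simps) (simp_all add: D_def algebra_simps)
  then have "?c \<in> ?U" by simp
  ultimately obtain X Y where XY: "open X" "open Y" "?c \<in> X \<times> Y" "X \<times> Y \<subseteq> ?U"
    by (rule open_prod_elim)
  have dense: "\<exists>r\<in>\<rat>. r \<in> S" if S: "open S" "c \<in> S" for S and c :: real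
  proof -
    obtain e where e: "0 < e" "ball c e \<subseteq> S" using S by (rule openE)
    obtain r where "r \<in> \<rat>" "c < r" "r < c + e" using Rats_dense_in_real[of c "c + e"] e(1) by auto
    then have "r \<in> ball c e" by (simp add: dist_real_def)
    then show ?thesis using e(2) \<open>r \<in> \<rat>\<close> by blast
  qed
  obtain p q where pq: "p \<in> \<rat>" "p \<in> X" "q \<in> \<rat>" "q \<in> Y"
    using dense[OF XY(1)] dense[OF XY(2)] XY(3) by blast
  have "p = p0 + s (p, q) * A1 + t (p, q) * B1"
    using D by (simp add: s_def t_def field_simps) (simp add: D_def algebra_simps)
  moreover have "q = q0 + s (p, q) * A2 + t (p, q) * B2"
    using D by (simp add: s_def t_def field_simps) (simp add: D_def algebra_simps)
  moreover have "(p, q) \<in> ?U" using pq XY(4) by blast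
  ultimately show thesis using pq(1,3) by (intro that[of p q "s (p, q)" "t (p, q)"]) auto
qed

text \<open>
An affine form that is nonnegative at the vertices of a triangle and vanishes at an interior point
vanishes at all vertices, hence identically.
\<close>

lemma halfplane_through_interior_point:
  fixes \<alpha> \<beta> s t :: real
  assumes "A1 * B2 - B1 * A2 \<noteq> 0" "0 < s" "0 < t" "s + t < 1"
    "p = p0 + s * A1 + t * B1" "q = q0 + s * A2 + t * B2"
    "0 \<le> \<alpha> * (p0 - p) + \<beta> * (q0 - q)"
    "0 \<le> \<alpha> * (p0 + A1 - p) + \<beta> * (q0 + A2 - q)"
    "0 \<le> \<alpha> * (p0 + B1 - p) + \<beta> * (q0 + B2 - q)"
  shows "\<alpha> = 0 \<and> \<beta> = 0"
proof -
  \<comment> \<open>The values of the affine form at the three vertices are \<open>c\<close>,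
    \<open>c + a\<close> and \<open>c + b\<close>.\<close>
  define a where "a = \<alpha> * A1 + \<beta> * A2"
  define b where "b = \<alpha> * B1 + \<beta> * B2"
  define c where "c = \<alpha> * (p0 - p) + \<beta> * (q0 - q)"
  have c: "c = - s * a - t * b" using assms(5,6) by (simp add: a_def b_def c_def algebra_simps)
  have nonneg: "0 \<le> c" "0 \<le> c + a" "0 \<le> c + b"
    using assms(7-9) by (simp_all add: a_def b_def c_def algebra_simps)
  have "(1 - s - t) * c + s * (c + a) + t * (c + b) = 0" by (simp add: c algebra_simps)
  moreover have "0 \<le> (1 - s - t) * c" "0 \<le> s * (c + a)" "0 \<le> t * (c + b)"
    using nonneg assms(2-4) by simp_all
  ultimately have "(1 - s - t) * c = 0" "s * (c + a) = 0" "t * (c + b) = 0" by linarith+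
  then have "c = 0" "a = 0" "b = 0" using assms(2-4) by simp_all
  then have "\<alpha> * (A1 * B2 - B1 * A2) = 0" "\<beta> * (A1 * B2 - B1 * A2) = 0"
    unfolding a_def b_def by algebra+
  then show ?thesis using assms(1) by simp
qed

lemma compact_decseq_subset_open:
  fixes K :: "nat \<Rightarrow> 'a::t2_space set"
  assumes "decseq K" "\<And>n. compact (K n)" "open U" "(\<Inter>n. K n) \<subseteq> U"
  shows "\<exists>n. K n \<subseteq> U"
proof -
  have o: "open (- K n)" for n using assms(2) by (simp add: compact_imp_closed open_Compl)
  have c: "compact (K 0 - U)" using assms by (intro compact_diff)
  have cov: "K 0 - U \<subseteq> (\<Union>n\<in>UNIV. - K n)" using assms(4) by blast
  obtain I where I: "finite I" "K 0 - U \<subseteq> (\<Union>n\<in>I. - K n)"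
    by (rule compactE_image[OF c o cov])
  have "K (Max (insert 0 I)) \<subseteq> U"
  proof (rule ccontr)
    assume "\<not> ?thesis"
    then obtain x where x: "x \<in> K (Max (insert 0 I))" "x \<notin> U" by blast
    have "x \<in> K n" if "n \<in> insert 0 I" for n
      using assms(1) x(1) Max_ge[OF _ that] I(1) by (auto simp: decseq_def)
    then show False using I(2) x(2) by blast
  qed
  then show ?thesis by blast
qed

text \<open>
The end points are the minimum and the maximum on \<open>S\<close> of a functional that is injective on the
line containing \<open>S\<close>.
\<close>

lemma collinear_compact_convex_is_segment:
  fixes S :: "'a::frechet_space set"
  assumes "compact S" "convex S" "S \<noteq> {}"
    and coll: "\<And>x y z. x \<in> S \<Longrightarrow> y \<in> S \<Longrightarrow> z \<in> S \<Longrightarrow> x \<noteq> y \<Longrightarrow> \<exists>s. z - x = s *\<^sub>R (y - x)"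
  shows "\<exists>a b. S = closed_segment a b"
proof (cases "\<exists>x. S = {x}")
  case True
  then show ?thesis by (metis closed_segment_idem)
next
  case False
  then obtain x y where xy: "x \<in> S" "y \<in> S" "x \<noteq> y" using assms(3) by blast
  then obtain l where l: "linear l" "continuous_on UNIV l" "l (y - x) \<noteq> (0::real)"
    using separating_functional[of "y - x"] by auto
  have cont: "continuous_on S l" using l(2) by (rule continuous_on_subset) simp
  obtain a where a: "a \<in> S" "\<And>z. z \<in> S \<Longrightarrow> l a \<le> l z"
    using continuous_attains_inf[OF assms(1,3) cont] by blast
  obtain b where b: "b \<in> S" "\<And>z. z \<in> S \<Longrightarrow> l z \<le> l b"
    using continuous_attains_sup[OF assms(1,3) cont] by blast
  have "l x \<noteq> l y" using l(1,3) by (simp add: linear_diff)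
  then have lab: "l a < l b" using a(2)[of x] a(2)[of y] b(2)[of x] b(2)[of y] xy by linarith
  have "z \<in> closed_segment a b" if z: "z \<in> S" for z
  proof -
    have "a \<noteq> b" using lab by auto
    from coll[OF a(1) b(1) z this] obtain s where s: "z - a = s *\<^sub>R (b - a)" by blast
    then have "l (z - a) = l (s *\<^sub>R (b - a))" by simp
    then have "l z - l a = s * (l b - l a)" using l(1) by (simp add: linear_diff linear_scale)
    then have s': "s = (l z - l a) / (l b - l a)" using lab by (simp add: field_simps)
    have "0 \<le> s" "s \<le> 1" unfolding s' using a(2)[OF z] b(2)[OF z] lab by (simp_all add: divide_simps)
    moreover have "z = (1 - s) *\<^sub>R a + s *\<^sub>R b" using s by (simp add: algebra_simps)
    ultimately show ?thesis by (auto simp: in_segment)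
  qed
  then have "S = closed_segment a b" using closed_segment_subset[OF a(1) b(1) assms(2)] by blast
  then show ?thesis by blast
qed

text \<open>
It is enough that \<open>L\<close> separates the points of the difference set \<open>K - K\<close> from the origin: this set
is convex and symmetric, so the vector to be detected lies in it after scaling.
\<close>

lemma noncollinear_separated_by_pair:
  fixes K :: "'a::real_vector set" and L :: "('a \<Rightarrow> real) set"
  assumes K: "convex K" "x \<in> K" "y \<in> K" "z \<in> K" "x \<noteq> y"
    and L: "\<And>l. l \<in> L \<Longrightarrow> linear l"
      "\<And>w. w \<in> (\<lambda>p. fst p - snd p) ` (K \<times> K) \<Longrightarrow> w \<noteq> 0 \<Longrightarrow> \<exists>l\<in>L. l w \<noteq> 0"
    and nc: "\<nexists>s. z - x = s *\<^sub>R (y - x)"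
  shows "\<exists>l\<in>L. \<exists>m\<in>L. l (y - x) * m (z - x) - l (z - x) * m (y - x) \<noteq> 0"
proof -
  let ?D = "(\<lambda>p. fst p - snd p) ` (K \<times> K)"
  have diff: "u - v \<in> ?D" if "u \<in> K" "v \<in> K" for u v using that by force
  have "convex ?D"
  proof -
    have "?D = (\<Union>x\<in>K. \<Union>y\<in>K. {x - y})" by (force simp: image_iff)
    then show ?thesis using convex_differences[OF K(1) K(1)] by simp
  qed
  obtain l where l: "l \<in> L" "l (y - x) \<noteq> 0" using L(2)[OF diff[OF K(3,2)]] K(5) by auto
  \<comment> \<open>The vector \<open>w\<close> is the part of \<open>z - x\<close> annihilated by
    \<open>l\<close>; a functional \<open>m\<close> that does not annihilate it
    makes the determinant nonzero.\<close>
  define s where "s = l (z - x) / l (y - x)"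
  define w where "w = (z - x) - s *\<^sub>R (y - x)"
  define y' where "y' = (if 0 \<le> s then x - y else y - x)"
  have "w \<noteq> 0" using nc by (auto simp: w_def)
  have "(1 / (1 + \<bar>s\<bar>)) *\<^sub>R (z - x) + (\<bar>s\<bar> / (1 + \<bar>s\<bar>)) *\<^sub>R y' \<in> ?D"
    using diff K by (intro convexD[OF \<open>convex ?D\<close>]) (auto simp: y'_def simp flip: add_divide_distrib)
  moreover have "(1 / (1 + \<bar>s\<bar>)) *\<^sub>R (z - x) + (\<bar>s\<bar> / (1 + \<bar>s\<bar>)) *\<^sub>R y' = (1 / (1 + \<bar>s\<bar>)) *\<^sub>R w"
  proof -
    have "\<bar>s\<bar> *\<^sub>R y' = - s *\<^sub>R (y - x)" by (auto simp: y'_def algebra_simps)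
    then have "w = (z - x) + \<bar>s\<bar> *\<^sub>R y'" by (simp add: w_def)
    then show ?thesis by (simp add: scaleR_add_right)
  qed
  ultimately have "(1 / (1 + \<bar>s\<bar>)) *\<^sub>R w \<in> ?D" by simp
  moreover have "(1 / (1 + \<bar>s\<bar>)) *\<^sub>R w \<noteq> 0" using \<open>w \<noteq> 0\<close> by simp
  ultimately obtain m where m: "m \<in> L" "m ((1 / (1 + \<bar>s\<bar>)) *\<^sub>R w) \<noteq> 0" using L(2) by blast
  have "m w \<noteq> 0" using m(2) by (auto simp: linear_scale[OF L(1)[OF m(1)]])
  moreover have "m w = m (z - x) - s * m (y - x)"
    unfolding w_def by (simp only: linear_diff[OF L(1)[OF m(1)], of "z - x"] linear_scale[OF L(1)[OF m(1)]]) simp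
  ultimately have "l (y - x) * m (z - x) - l (z - x) * m (y - x) \<noteq> 0"
    using l(2) by (auto simp: s_def field_simps)
  then show ?thesis using l(1) m(1) by blast
qed

text \<open>
All cuts prescribed by pairs of functionals and rational points are made one after another.
Three noncollinear points in the intersection would span a triangle one of whose interior points
was used for a cut, which \<open>halfplane_through_interior_point\<close> forbids.
\<close>

lemma localization_sequence:
  fixes \<mu> :: "'a::frechet_space measure" and f g :: "'a \<Rightarrow> real"
  assumes \<mu>: "prob_space \<mu>" "borel_measure \<mu>" "zero_one_law \<mu>" and C: "compact C" "convex C"
    and f: "integrable \<mu> f" "0 < (LINT x:C|\<mu>. f x)" and g: "integrable \<mu> g" "0 < (LINT x:C|\<mu>. g x)"
  obtains K a b where "decseq K" "\<And>n. compact (K n)" "\<And>n. convex (K n)" "\<And>n. K n \<subseteq> C"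
    "\<And>n. 0 < (LINT x:K n|\<mu>. f x)" "\<And>n. 0 < (LINT x:K n|\<mu>. g x)" "(\<Inter>n. K n) = closed_segment a b"
proof -
  let ?D = "(\<lambda>p. fst p - snd p) ` (C \<times> C)"
  have "compact ?D" by (intro compact_continuous_image compact_Times C continuous_intros)
  then obtain L0 :: "('a \<Rightarrow> real) set" where L0: "countable L0" "\<And>l. l \<in> L0 \<Longrightarrow> linear l"
    "\<And>l. l \<in> L0 \<Longrightarrow> continuous_on UNIV l" "\<And>x. x \<in> ?D \<Longrightarrow> x \<noteq> 0 \<Longrightarrow> \<exists>l\<in>L0. l x \<noteq> 0"
    by (rule countable_separating_functionals) blast
  \<comment> \<open>The zero functional only serves to make the set of cuts nonempty, so that it can
    be enumerated.\<close>
  define L where "L = insert (\<lambda>_. 0) L0"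
  have L: "countable L" "linear l" "continuous_on UNIV l" if "l \<in> L" for l
    using L0(1-3) that by (auto simp: L_def linear_zero)
  define T where "T = L \<times> L \<times> (\<rat> :: real set) \<times> (\<rat> :: real set)"
  have "T \<noteq> {}" by (auto simp: T_def L_def)
  have "countable T" using L0(1) by (auto simp: T_def L_def countable_rat)
  define e where "e = from_nat_into T"
  have e: "e n \<in> T" for n using \<open>T \<noteq> {}\<close> by (simp add: e_def from_nat_into)
  have e_surj: "\<exists>n. e n = \<tau>" if "\<tau> \<in> T" for \<tau>
    using that \<open>countable T\<close> unfolding e_def by (metis from_nat_into_surj)
  define good where "good A \<longleftrightarrow> compact A \<and> convex A \<and> A \<subseteq> C \<and>
      0 < (LINT x:A|\<mu>. f x) \<and> 0 < (LINT x:A|\<mu>. g x)" for A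
  define cut where "cut \<tau> A \<longleftrightarrow> (case \<tau> of (l, m, p, q) \<Rightarrow> \<exists>\<alpha> \<beta>. (\<alpha> \<noteq> 0 \<or> \<beta> \<noteq> 0) \<and>
      (\<forall>x\<in>A. 0 \<le> \<alpha> * (l x - p) + \<beta> * (m x - q)))" for \<tau> :: "('a \<Rightarrow> real) \<times> ('a \<Rightarrow> real) \<times> real \<times> real" and A
  have step: "\<exists>B. good B \<and> (B \<subseteq> A \<and> cut (e n) B)" if A: "good A" for A n
  proof -
    obtain l m p q where lm: "e n = (l, m, p, q)" by (cases "e n") auto
    then have "l \<in> L" "m \<in> L" using e[of n] by (auto simp: T_def)
    obtain B \<alpha> \<beta> where "compact B" "convex B" "B \<subseteq> A"
      "0 < (LINT x:B|\<mu>. f x)" "0 < (LINT x:B|\<mu>. g x)"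
      "\<alpha> \<noteq> 0 \<or> \<beta> \<noteq> (0::real)" "\<And>x. x \<in> B \<Longrightarrow> 0 \<le> \<alpha> * (l x - p) + \<beta> * (m x - q)"
      by (rule bisection[of \<mu> A f g l m p q])
        (use \<mu> A f g L \<open>l \<in> L\<close> \<open>m \<in> L\<close> in \<open>auto simp: good_def\<close>)
    then show ?thesis using A lm by (intro exI[of _ B]) (auto simp: good_def cut_def)
  qed
  have "good C" using C f g by (simp add: good_def)
  then have "\<exists>K. \<forall>n. good (K n) \<and> (K (Suc n) \<subseteq> K n \<and> cut (e n) (K (Suc n)))"
    using step by (intro dependent_nat_choice) auto
  then obtain K where K: "\<And>n. good (K n)" "\<And>n. K (Suc n) \<subseteq> K n" "\<And>n. cut (e n) (K (Suc n))"
    by blast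
  have dec: "decseq K" using K(2) by (rule decseq_SucI)
  let ?I = "\<Inter>n. K n"
  have cpt: "compact (K n)" for n using K(1) by (simp add: good_def)
  have "?I \<noteq> {}"
  proof
    assume "?I = {}"
    then obtain n where "K n \<subseteq> {}"
      using compact_decseq_subset_open[OF dec cpt, of "{}"] by auto
    then show False using K(1)[of n] by (auto simp: good_def set_lebesgue_integral_def)
  qed
  moreover have "compact ?I"
  proof -
    have "closed ?I" using cpt by (auto intro: compact_imp_closed)
    then have "compact (K 0 \<inter> ?I)" by (rule compact_Int_closed[OF cpt])
    moreover have "K 0 \<inter> ?I = ?I" by blast
    ultimately show ?thesis by simp
  qed
  moreover have "convex ?I" using K(1) by (auto intro!: convex_Inter simp: good_def)
  moreover have "\<exists>s. z - x = s *\<^sub>R (y - x)" if xyz: "x \<in> ?I" "y \<in> ?I" "z \<in> ?I" "x \<noteq> y" for x y z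
  proof (rule ccontr)
    assume nc: "\<nexists>s. z - x = s *\<^sub>R (y - x)"
    have "?I \<subseteq> C" using K(1) by (auto simp: good_def)
    then have "x \<in> C" "y \<in> C" "z \<in> C" using xyz by auto
    then have "\<exists>l\<in>L0. \<exists>m\<in>L0. l (y - x) * m (z - x) - l (z - x) * m (y - x) \<noteq> 0"
      by (intro noncollinear_separated_by_pair[OF C(2) _ _ _ xyz(4) L0(2,4) nc])
    then obtain l m where lm: "l \<in> L" "m \<in> L" and det: "l (y - x) * m (z - x) - l (z - x) * m (y - x) \<noteq> 0"
      by (auto simp: L_def)
    obtain p q s t where pq: "p \<in> \<rat>" "q \<in> \<rat>" "0 < s" "0 < t" "s + t < 1"
      "p = l x + s * l (y - x) + t * l (z - x)" "q = m x + s * m (y - x) + t * m (z - x)"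
      using rational_point_in_triangle[OF det] .
    have "(l, m, p, q) \<in> T" using lm pq by (simp add: T_def)
    then obtain n where "e n = (l, m, p, q)" using e_surj by blast
    then obtain \<alpha> \<beta> where \<alpha>\<beta>: "\<alpha> \<noteq> 0 \<or> \<beta> \<noteq> 0"
      "\<And>x. x \<in> K (Suc n) \<Longrightarrow> 0 \<le> \<alpha> * (l x - p) + \<beta> * (m x - q)"
      using K(3)[of n] by (auto simp: cut_def)
    have "x \<in> K (Suc n)" "y \<in> K (Suc n)" "z \<in> K (Suc n)" using xyz by auto
    from this[THEN \<alpha>\<beta>(2)] have "\<alpha> = 0 \<and> \<beta> = 0"
      by (intro halfplane_through_interior_point[OF det pq(3-7)])
        (simp_all add: linear_diff[OF L(2)[OF lm(1)]] linear_diff[OF L(2)[OF lm(2)]])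
    then show False using \<alpha>\<beta>(1) by simp
  qed
  ultimately have "\<exists>a b. ?I = closed_segment a b"
    by (intro collinear_compact_convex_is_segment)
  then obtain a b where "?I = closed_segment a b" by blast
  with dec K(1) show thesis by (intro that[of K a b]) (auto simp: good_def)
qed

section \<open>Limit measures on a segment\<close>

lemma compact_closed_segment_frechet: "compact (closed_segment a (b::'a::frechet_space))"
  unfolding closed_segment_image_interval
  by (intro compact_continuous_image continuous_intros) auto

lemma integral_uniform_measure_borel:
  fixes f :: "'a \<Rightarrow> real"
  assumes "finite_measure M" "f \<in> borel_measurable M" "K \<in> sets M" "0 < emeasure M K"
  shows "integral\<^sup>L (uniform_measure M K) f = (LINT x:K|M. f x) / measure M K"
proof -
  interpret finite_measure M by fact
  have pos: "0 < measure M K" using assms(4) by (simp add: emeasure_eq_measure)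
  have [measurable]: "f \<in> borel_measurable M" "K \<in> sets M" using assms by auto
  have "uniform_measure M K = density M (\<lambda>x. ennreal (indicator K x / measure M K))"
    unfolding uniform_measure_def
    using pos by (intro arg_cong[where f = "density M"] ext)
      (auto simp: emeasure_eq_measure indicator_def divide_ennreal simp flip: ennreal_1)
  then have "integral\<^sup>L (uniform_measure M K) f = (\<integral>x. (indicator K x / measure M K) *\<^sub>R f x \<partial>M)"
    by (simp add: integral_density)
  also have "\<dots> = (\<integral>x. (indicator K x *\<^sub>R f x) / measure M K \<partial>M)"
    by (intro Bochner_Integration.integral_cong) auto
  finally show ?thesis by (simp add: set_lebesgue_integral_def)
qed

text \<open>
A continuous retraction onto the segment that factors through the real line, so that weak limits on
the segment can be computed from distributions on the line.
\<close>

lemma segment_retraction: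
  fixes a b :: "'a::frechet_space"
  obtains l :: "'a \<Rightarrow> real" and \<gamma> where "continuous_on UNIV l" "continuous_on UNIV \<gamma>"
    "\<And>s. \<gamma> s \<in> closed_segment a b" "\<And>x. x \<in> closed_segment a b \<Longrightarrow> \<gamma> (l x) = x"
proof -
  obtain l :: "'a \<Rightarrow> real" where l: "linear l" "continuous_on UNIV l" "a \<noteq> b \<Longrightarrow> l (b - a) \<noteq> 0"
  proof (cases "a = b")
    case True
    then show thesis by (intro that[of "\<lambda>_. 0"]) (auto simp: linear_zero)
  next
    case False
    then show thesis using separating_functional[of "b - a"] that by auto
  qed
  \<comment> \<open>If \<open>a = b\<close>, the quotient is 0 by convention and
    \<open>\<gamma>\<close> is constant.\<close>
  define c where "c s = max 0 (min 1 ((s - l a) / (l b - l a)))" for s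
  define \<gamma> where "\<gamma> s = (1 - c s) *\<^sub>R a + c s *\<^sub>R b" for s
  show thesis
  proof (rule that[of l \<gamma>])
    show "continuous_on UNIV \<gamma>"
    proof (cases "l b = l a")
      case True
      then show ?thesis by (simp add: \<gamma>_def c_def)
    next
      case False
      then show ?thesis unfolding \<gamma>_def c_def by (intro continuous_intros) auto
    qed
    show "\<gamma> s \<in> closed_segment a b" for s
      unfolding in_segment \<gamma>_def by (intro exI[of _ "c s"]) (auto simp: c_def)
    fix x assume "x \<in> closed_segment a b"
    then obtain u where u: "0 \<le> u" "u \<le> 1" "x = (1 - u) *\<^sub>R a + u *\<^sub>R b" by (auto simp: in_segment)
    show "\<gamma> (l x) = x"
    proof (cases "a = b")
      case True
      then show ?thesis using u by (simp add: \<gamma>_def flip: scaleR_add_left)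
    next
      case False
      then have "l b - l a \<noteq> 0" using l by (simp add: linear_diff)
      moreover have "l x = (1 - u) * l a + u * l b"
        unfolding u(3) using l(1) by (simp add: linear_add linear_scale)
      then have "l x - l a = u * (l b - l a)" by (simp add: algebra_simps)
      ultimately have "c (l x) = u" using u by (simp add: c_def)
      then show ?thesis using u by (simp add: \<gamma>_def)
    qed
  qed (rule l)
qed

text \<open>
The images of the restricted measures under the functional \<open>l\<close> live on a common bounded interval, so
Helly's theorem provides a weakly convergent subsequence; \<open>\<nu>\<close> is the image of its limit under
\<open>\<gamma>\<close>.  Passing from a test function \<open>w\<close> to \<open>w \<circ> \<gamma> \<circ> l\<close> changes nothing in the
limit: the two agree on the segment, hence are uniformly close on \<open>K n\<close> for large \<open>n\<close>.
\<close>

lemma uniform_measures_cluster_on_segment: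
  fixes \<mu> :: "'a::frechet_space measure"
  assumes "prob_space \<mu>" "borel_measure \<mu>" and dec: "decseq K" and cpt: "\<And>n. compact (K n)"
    and pos: "\<And>n. 0 < emeasure \<mu> (K n)" and seg: "(\<Inter>n. K n) = closed_segment a b"
  obtains \<nu> r where "strict_mono r" "prob_space \<nu>" "borel_measure \<nu>"
    "supported_on \<nu> (closed_segment a b)" "weakly_converges (\<lambda>n. uniform_measure \<mu> (K (r n))) \<nu>"
proof -
  interpret \<mu>: prob_space \<mu> by fact
  have sets: "sets \<mu> = sets borel" using assms(2) by (simp add: borel_measure_def)
  define U where "U n = uniform_measure \<mu> (K n)" for n
  have setsU: "sets (U n) = sets borel" for n by (simp add: U_def sets)
  have spaceU: "space (U n) = UNIV" for n using sets_eq_imp_space_eq[OF setsU] by simp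
  have U: "prob_space (U n)" for n
    unfolding U_def using pos[of n] by (intro prob_space_uniform_measure) (auto simp: \<mu>.emeasure_eq_measure)
  have K: "K n \<in> sets \<mu>" for n using cpt by (simp add: sets compact_imp_closed)
  have aeU: "AE x in U n. x \<in> K n" for n
    unfolding U_def using K[of n] by (intro AE_uniform_measureI) auto
  have contU: "h \<in> borel_measurable (U n)" if "continuous_on UNIV h" for h :: "'a \<Rightarrow> real" and n
    using borel_measurable_continuous_onI[OF that] by (simp add: measurable_cong_sets[OF setsU refl])
  obtain l :: "'a \<Rightarrow> real" and \<gamma> where l: "continuous_on UNIV l" and \<gamma>: "continuous_on UNIV \<gamma>"
    "\<And>s. \<gamma> s \<in> closed_segment a b" "\<And>x. x \<in> closed_segment a b \<Longrightarrow> \<gamma> (l x) = x"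
    by (rule segment_retraction[of a b]) blast
  define M where "M n = distr (U n) borel l" for n
  have M: "real_distribution (M n)" for n
    unfolding M_def by (intro prob_space.real_distribution_distr U contU l)
  have "tight M"
    unfolding tight_def
  proof (intro conjI allI impI M)
    fix \<epsilon> :: real assume "\<epsilon> > 0"
    have "bounded (l ` K 0)"
      by (intro compact_imp_bounded compact_continuous_image cpt continuous_on_subset[OF l]) auto
    then obtain B where B: "\<And>x. x \<in> K 0 \<Longrightarrow> \<bar>l x\<bar> \<le> B" by (auto simp: bounded_iff)
    have "measure (M n) {- \<bar>B\<bar> - 1<..\<bar>B\<bar>} = 1" for n
    proof -
      interpret Mn: real_distribution "M n" by (rule M)
      have "AE x in U n. l x \<in> {- \<bar>B\<bar> - 1<..\<bar>B\<bar>}"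
        using aeU[of n]
      proof eventually_elim
        case (elim x)
        then have "x \<in> K 0" using dec by (auto simp: decseq_def)
        from B[OF this] show ?case by auto
      qed
      then have "AE y in M n. y \<in> {- \<bar>B\<bar> - 1<..\<bar>B\<bar>}"
        unfolding M_def using contU[OF l, of n] by (subst AE_distr_iff) auto
      then show ?thesis by (subst (asm) Mn.prob_eq_1[symmetric]) auto
    qed
    then show "\<exists>a b. a < b \<and> (\<forall>n. 1 - \<epsilon> < measure (M n) {a<..b})"
      using \<open>\<epsilon> > 0\<close> by (intro exI[of _ "- \<bar>B\<bar> - 1"] exI[of _ "\<bar>B\<bar>"]) auto
  qed
  from tight_imp_convergent_subsubsequence[OF this strict_mono_id]
  obtain r M' where r: "strict_mono r" and M': "real_distribution M'" and conv: "weak_conv_m (\<lambda>n. M (r n)) M'"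
    by (auto simp: comp_def)
  interpret M': real_distribution M' by (rule M')
  have \<gamma>_meas [measurable]: "\<gamma> \<in> borel_measurable borel"
    by (rule borel_measurable_continuous_onI[OF \<gamma>(1)])
  define \<nu> where "\<nu> = distr M' borel \<gamma>"
  have "prob_space \<nu>" unfolding \<nu>_def by (intro M'.prob_space_distr) simp
  moreover have "borel_measure \<nu>" by (simp add: borel_measure_def \<nu>_def)
  moreover have "supported_on \<nu> (closed_segment a b)"
  proof -
    have cl: "closed (closed_segment a b)" by (intro compact_imp_closed compact_closed_segment_frechet)
    have "\<gamma> -` (- closed_segment a b) = {}" using \<gamma>(2) by auto
    then show ?thesis using cl by (simp add: supported_on_def \<nu>_def emeasure_distr)
  qed
  moreover have "weakly_converges (\<lambda>n. U (r n)) \<nu>"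
    unfolding weakly_converges_def
  proof (intro allI impI)
    fix w :: "'a \<Rightarrow> real" assume "continuous_on UNIV w \<and> bounded (range w)"
    then have w: "continuous_on UNIV w" and "bounded (range w)" by auto
    then obtain B where B: "\<And>x. \<bar>w x\<bar> \<le> B" by (auto simp: bounded_iff)
    have w\<gamma>: "continuous_on UNIV (\<lambda>s. w (\<gamma> s))"
      by (rule continuous_on_compose2[OF w \<gamma>(1)]) auto
    have w\<gamma>l: "continuous_on UNIV (\<lambda>x. w (\<gamma> (l x)))"
      by (rule continuous_on_compose2[OF w\<gamma> l]) auto
    have int: "integrable (U n) h" if "continuous_on UNIV h" "\<And>x. \<bar>h x\<bar> \<le> B" for h n
    proof -
      interpret Un: prob_space "U n" by (rule U)
      show ?thesis using that by (intro Un.integrable_const_bound[of _ B] contU) auto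
    qed
    have "(\<lambda>n. integral\<^sup>L (M (r n)) (\<lambda>s. w (\<gamma> s))) \<longlonglongrightarrow> integral\<^sup>L M' (\<lambda>s. w (\<gamma> s))"
      by (rule weak_conv_imp_integral_bdd_continuous_conv[OF M M' conv, of _ B])
        (use w\<gamma> B in \<open>auto simp: continuous_on_eq_continuous_at\<close>)
    moreover have "integral\<^sup>L M' (\<lambda>s. w (\<gamma> s)) = integral\<^sup>L \<nu> w"
      unfolding \<nu>_def using borel_measurable_continuous_onI[OF w] by (subst integral_distr) auto
    moreover have "integral\<^sup>L (M n) (\<lambda>s. w (\<gamma> s)) = integral\<^sup>L (U n) (\<lambda>x. w (\<gamma> (l x)))" for n
      unfolding M_def using borel_measurable_continuous_onI[OF w\<gamma>] contU[OF l]
      by (subst integral_distr) auto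
    ultimately have lim: "(\<lambda>n. integral\<^sup>L (U (r n)) (\<lambda>x. w (\<gamma> (l x)))) \<longlonglongrightarrow> integral\<^sup>L \<nu> w" by simp
    have "(\<lambda>n. integral\<^sup>L (U n) w - integral\<^sup>L (U n) (\<lambda>x. w (\<gamma> (l x)))) \<longlonglongrightarrow> 0"
    proof (rule LIMSEQ_I)
      fix e :: real assume e: "e > 0"
      let ?V = "{x. \<bar>w x - w (\<gamma> (l x))\<bar> < e / 2}"
      have "open ?V" by (intro open_Collect_less continuous_intros w w\<gamma>l)
      moreover have "(\<Inter>n. K n) \<subseteq> ?V" using e \<gamma>(3) by (auto simp: seg)
      ultimately obtain N where N: "K N \<subseteq> ?V" using compact_decseq_subset_open[OF dec cpt] by blast
      have "norm (integral\<^sup>L (U n) w - integral\<^sup>L (U n) (\<lambda>x. w (\<gamma> (l x))) - 0) < e" if n: "N \<le> n" for n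
      proof -
        interpret Un: prob_space "U n" by (rule U)
        have i: "integrable (U n) w" "integrable (U n) (\<lambda>x. w (\<gamma> (l x)))"
          using w w\<gamma>l B by (auto intro!: int)
        have "norm (\<integral>x. w x - w (\<gamma> (l x)) \<partial>U n) \<le> (\<integral>x. norm (w x - w (\<gamma> (l x))) \<partial>U n)"
          by (rule integral_norm_bound)
        also have "\<dots> \<le> (\<integral>x. e / 2 \<partial>U n)"
        proof (rule integral_mono_AE)
          show "AE x in U n. norm (w x - w (\<gamma> (l x))) \<le> e / 2"
            using aeU[of n]
          proof eventually_elim
            case (elim x)
            then have "x \<in> K N" using dec n by (auto simp: decseq_def)
            then show ?case using N by force
          qed
        qed (use i in auto)
        also have "\<dots> < e" using e by (simp add: Un.prob_space)
        finally show ?thesis using i by simp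
      qed
      then show "\<exists>N. \<forall>n\<ge>N. norm (integral\<^sup>L (U n) w - integral\<^sup>L (U n) (\<lambda>x. w (\<gamma> (l x))) - 0) < e" by blast
    qed
    from tendsto_add[OF LIMSEQ_subseq_LIMSEQ[OF this r] lim]
    show "(\<lambda>n. integral\<^sup>L (U (r n)) w) \<longlonglongrightarrow> integral\<^sup>L \<nu> w" by (simp add: comp_def)
  qed
  ultimately show thesis using that[OF r] by (simp add: U_def)
qed

section \<open>Existence of the needle\<close>

lemma ext_integral_pos:
  assumes "prob_space N" "borel_measure N" "continuous_on UNIV f" "bounded (range f)"
    "AE x in N. f x \<le> u x" "0 < integral\<^sup>L N f"
  shows "0 < ext_integral N u"
proof -
  interpret prob_space N by fact
  have sets: "sets N = sets borel" using assms(2) by (simp add: borel_measure_def)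
  obtain B where B: "\<And>x. \<bar>f x\<bar> \<le> B" using assms(4) by (auto simp: bounded_iff)
  have f: "integrable N f"
    using borel_measurable_continuous_onI[OF assms(3)] B
    by (intro integrable_const_bound[of _ B]) (auto simp: measurable_cong_sets[OF sets refl])
  let ?P = "\<integral>\<^sup>+ x. ennreal (f x) \<partial>N" and ?Q = "\<integral>\<^sup>+ x. ennreal (- f x) \<partial>N"
  have fin: "?P \<noteq> \<infinity>" "?Q \<noteq> \<infinity>" using f by (auto simp: real_integrable_def)
  have "enn2real ?Q < enn2real ?P" using assms(6) by (simp add: real_lebesgue_integral_def[OF f])
  then have "?Q < ?P" using fin by (metis enn2real_mono infinity_ennreal_def not_le top.not_eq_extremum)
  have "(\<integral>\<^sup>+ x. ennreal (- u x) \<partial>N) \<le> ?Q"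
    using assms(5) by (intro nn_integral_mono_AE) (auto simp: ennreal_leI)
  also note \<open>?Q < ?P\<close>
  also have "?P \<le> (\<integral>\<^sup>+ x. ennreal (u x) \<partial>N)"
    using assms(5) by (intro nn_integral_mono_AE) (auto simp: ennreal_leI)
  finally show ?thesis unfolding ext_integral_def
    by (intro ereal_diff_gr0) (simp add: less_ennreal.rep_eq)
qed

lemma set_integral_shift:
  fixes f :: "'a \<Rightarrow> real"
  assumes "finite_measure M" "integrable M f" "K \<in> sets M"
  shows "(LINT x:K|M. f x - c) = (LINT x:K|M. f x) - c * measure M K"
proof -
  interpret finite_measure M by fact
  have "integrable M (\<lambda>x. indicator K x *\<^sub>R f x)" using assms(2,3) by (intro integrable_mult_indicator)
  moreover have "integrable M (\<lambda>x. indicator K x *\<^sub>R c)"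
    using assms(3) by (intro integrable_mult_indicator) auto
  ultimately show ?thesis
    using assms(3) by (simp add: set_lebesgue_integral_def right_diff_distrib sets.Int_space_eq2)
qed

text \<open>
The averages of \<open>f\<close> and \<open>g\<close> over the sets \<open>K n\<close> stay above a fixed \<open>\<epsilon>\<close>, so the same holds for
their integrals with respect to \<open>\<nu>\<close>, and these are lower bounds for the integrals of \<open>u\<close> and \<open>v\<close>.
\<close>

lemma needle_in_support:
  fixes \<mu> :: "'a::frechet_space measure" and u v :: "'a \<Rightarrow> real"
  assumes \<mu>: "prob_space \<mu>" "borel_measure \<mu>" and "\<exists>C. compact C \<and> 0 < emeasure \<mu> C"
    and "zero_one_law \<mu>" and lsc: "lower_semicontinuous u" "lower_semicontinuous v"
    and int: "integrable \<mu> u" "integrable \<mu> v"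
    and pos: "0 < integral\<^sup>L \<mu> u" "0 < integral\<^sup>L \<mu> v"
    and F: "convex F" "supported_on \<mu> F"
  shows "\<exists>\<nu>. needle \<mu> \<nu> \<and> supported_on \<nu> F \<and> 0 < ext_integral \<nu> u \<and> 0 < ext_integral \<nu> v"
proof -
  interpret prob_space \<mu> by fact
  have sets: "sets \<mu> = sets borel" using \<mu>(2) by (simp add: borel_measure_def)
  have compact_sets: "A \<in> sets \<mu>" if "compact A" for A
    using that by (simp add: sets compact_imp_closed)
  obtain C0 where "compact C0" "0 < emeasure \<mu> C0" using assms(3) by blast
  then obtain C where C: "compact C" "convex C" "C \<subseteq> F"
    "0 < (LINT x:C|\<mu>. u x)" "0 < (LINT x:C|\<mu>. v x)"
    by (rule compact_convex_with_positive_integrals[OF \<mu> assms(4) _ _ int pos F]) blast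
  obtain f where f: "continuous_on UNIV f" "bounded (range f)" "\<And>x. x \<in> C \<Longrightarrow> f x \<le> u x"
    "0 < (LINT x:C|\<mu>. f x)"
    by (rule continuous_minorant_with_positive_integral[OF \<mu> lsc(1) C(1) int(1) C(4)]) blast
  obtain g where g: "continuous_on UNIV g" "bounded (range g)" "\<And>x. x \<in> C \<Longrightarrow> g x \<le> v x"
    "0 < (LINT x:C|\<mu>. g x)"
    by (rule continuous_minorant_with_positive_integral[OF \<mu> lsc(2) C(1) int(2) C(5)]) blast
  have integrable: "integrable \<mu> h" if h: "continuous_on UNIV h" "bounded (range h)" for h :: "'a \<Rightarrow> real"
  proof -
    obtain B where B: "\<And>x. \<bar>h x\<bar> \<le> B" using h(2) by (auto simp: bounded_iff)
    show ?thesis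
      using borel_measurable_continuous_onI[OF h(1)] B
      by (intro integrable_const_bound[of _ B]) (auto simp: measurable_cong_sets[OF sets refl])
  qed
  \<comment> \<open>Since \<open>\<mu>\<close> is a probability measure, subtracting
    \<open>\<epsilon>\<close> costs at most half of either integral.\<close>
  define \<epsilon> where "\<epsilon> = min (LINT x:C|\<mu>. f x) (LINT x:C|\<mu>. g x) / 2"
  have \<epsilon>: "0 < \<epsilon>" using f(4) g(4) by (simp add: \<epsilon>_def)
  have shift: "(LINT x:K|\<mu>. h x - \<epsilon>) = (LINT x:K|\<mu>. h x) - \<epsilon> * measure \<mu> K"
    if "continuous_on UNIV h" "bounded (range h)" "compact K" for h K
    using that by (intro set_integral_shift integrable compact_sets) unfold_locales
  have "\<epsilon> * measure \<mu> C \<le> \<epsilon>" using \<epsilon> by (simp add: mult_left_le)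
  then have pos': "0 < (LINT x:C|\<mu>. f x - \<epsilon>)" "0 < (LINT x:C|\<mu>. g x - \<epsilon>)"
    using f(4) g(4) shift[OF f(1,2) C(1)] shift[OF g(1,2) C(1)] by (auto simp: \<epsilon>_def)
  have int': "integrable \<mu> (\<lambda>x. f x - \<epsilon>)" "integrable \<mu> (\<lambda>x. g x - \<epsilon>)"
    using integrable[OF f(1,2)] integrable[OF g(1,2)] by auto
  obtain K a b where K: "decseq K" "\<And>n. compact (K n)" "\<And>n. convex (K n)" "\<And>n. K n \<subseteq> C"
    "\<And>n. 0 < (LINT x:K n|\<mu>. f x - \<epsilon>)" "\<And>n. 0 < (LINT x:K n|\<mu>. g x - \<epsilon>)"
    "(\<Inter>n. K n) = closed_segment a b"
    by (rule localization_sequence[OF \<mu> assms(4) C(1,2) int'(1) pos'(1) int'(2) pos'(2)]) blast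
  have Kpos: "0 < emeasure \<mu> (K n)" for n
  proof (rule ccontr)
    assume "\<not> ?thesis"
    then have "AE x in \<mu>. x \<notin> K n"
      using compact_sets[OF K(2)] by (intro AE_not_in) (auto simp: null_sets_def)
    then have "(LINT x:K n|\<mu>. f x - \<epsilon>) = (\<integral>x. 0 \<partial>\<mu>)"
      unfolding set_lebesgue_integral_def by (intro integral_cong_AE) (use compact_sets[OF K(2)[of n]] int' in auto)
    then show False using K(5)[of n] by simp
  qed
  obtain \<nu> r where \<nu>: "strict_mono r" "prob_space \<nu>" "borel_measure \<nu>"
    "supported_on \<nu> (closed_segment a b)" "weakly_converges (\<lambda>n. uniform_measure \<mu> (K (r n))) \<nu>"
    by (rule uniform_measures_cluster_on_segment[OF \<mu> K(1,2) Kpos K(7)])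
  have "(\<Inter>n. K (r n)) = closed_segment a b"
  proof -
    have "K (r n) \<subseteq> K n" for n using K(1) seq_suble[OF \<nu>(1), of n] by (simp add: decseq_def)
    then have "(\<Inter>n. K (r n)) = (\<Inter>n. K n)" by blast
    then show ?thesis using K(7) by simp
  qed
  moreover have "decseq (\<lambda>n. K (r n))"
    using K(1) \<nu>(1) by (auto simp: decseq_def strict_mono_less_eq)
  ultimately have "needle \<mu> \<nu>"
    unfolding needle_def using \<nu>(2-5) K(2,3) Kpos
    by (intro conjI exI[of _ a] exI[of _ b] exI[of _ "\<lambda>n. K (r n)"]) auto
  moreover have "supported_on \<nu> F"
  proof -
    have "closed F" using F(2) by (simp add: supported_on_def)
    have "closed_segment a b \<subseteq> F" using K(4,7) C(3) by blast
    then have "emeasure \<nu> (- F) \<le> emeasure \<nu> (- closed_segment a b)"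
      using \<nu>(3,4) by (intro emeasure_mono) (auto simp: borel_measure_def supported_on_def)
    then show ?thesis using \<open>closed F\<close> \<nu>(4) by (simp add: supported_on_def)
  qed
  moreover have limit: "0 < integral\<^sup>L \<nu> h"
    if h: "continuous_on UNIV h" "bounded (range h)" "\<And>n. 0 < (LINT x:K n|\<mu>. h x - \<epsilon>)" for h
  proof -
    have "\<epsilon> \<le> integral\<^sup>L (uniform_measure \<mu> (K n)) h" for n
    proof -
      have m: "0 < measure \<mu> (K n)" using Kpos[of n] by (simp add: emeasure_eq_measure)
      have "integral\<^sup>L (uniform_measure \<mu> (K n)) h = (LINT x:K n|\<mu>. h x) / measure \<mu> (K n)"
        using integrable[OF h(1,2)] Kpos[of n] compact_sets[OF K(2)]
        by (intro integral_uniform_measure_borel) (auto intro: finite_measure_axioms)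
      moreover have "\<epsilon> * measure \<mu> (K n) < (LINT x:K n|\<mu>. h x)"
        using h(3)[of n] shift[OF h(1,2) K(2)[of n]] by simp
      ultimately show ?thesis using m by (simp add: pos_le_divide_eq)
    qed
    moreover have "(\<lambda>n. integral\<^sup>L (uniform_measure \<mu> (K (r n))) h) \<longlonglongrightarrow> integral\<^sup>L \<nu> h"
      using \<nu>(5) h(1,2) by (simp add: weakly_converges_def)
    ultimately have "\<epsilon> \<le> integral\<^sup>L \<nu> h" by (intro LIMSEQ_le_const) auto
    then show ?thesis using \<epsilon> by simp
  qed
  moreover have ae: "AE x in \<nu>. x \<in> C"
  proof -
    have "space \<nu> = UNIV" using \<nu>(3) sets_eq_imp_space_eq[of \<nu> borel] by (simp add: borel_measure_def)
    have "closed_segment a b \<subseteq> C" using K(4,7) by blast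
    then show ?thesis
      using \<nu>(3,4) \<open>space \<nu> = UNIV\<close>
      by (intro AE_I[of _ _ "- closed_segment a b"]) (auto simp: supported_on_def borel_measure_def)
  qed
  moreover have "0 < ext_integral \<nu> u"
    using ae f(3) by (intro ext_integral_pos[OF \<nu>(2,3) f(1,2)] limit f(1,2) K(5)) auto
  moreover have "0 < ext_integral \<nu> v"
    using ae g(3) by (intro ext_integral_pos[OF \<nu>(2,3) g(1,2)] limit g(1,2) K(6)) auto
  ultimately show ?thesis by blast
qed

theorem theorem4p3:
  fixes \<mu> :: "'a::frechet_space measure" and u v :: "'a \<Rightarrow> real"
  assumes "prob_space \<mu>" and "borel_measure \<mu>"
    and charges_compact: "\<exists>C. compact C \<and> 0 < emeasure \<mu> C"
    and "zero_one_law \<mu>"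
    and "lower_semicontinuous u" and "lower_semicontinuous v"
    and "integrable \<mu> u" and "integrable \<mu> v"
    and "0 < integral\<^sup>L \<mu> u" and "0 < integral\<^sup>L \<mu> v"
  shows "(\<exists>\<nu>. needle \<mu> \<nu> \<and> 0 < ext_integral \<nu> u \<and> 0 < ext_integral \<nu> v) \<and>
         (\<forall>F. convex F \<and> supported_on \<mu> F \<longrightarrow>
            (\<exists>\<nu>. needle \<mu> \<nu> \<and> supported_on \<nu> F \<and> 0 < ext_integral \<nu> u \<and> 0 < ext_integral \<nu> v))"
proof (intro conjI allI impI)
  have "supported_on \<mu> UNIV" by (simp add: supported_on_def)
  then show "\<exists>\<nu>. needle \<mu> \<nu> \<and> 0 < ext_integral \<nu> u \<and> 0 < ext_integral \<nu> v"
    using needle_in_support[OF assms convex_UNIV] by blast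
next
  fix F assume "convex F \<and> supported_on \<mu> F"
  then show "\<exists>\<nu>. needle \<mu> \<nu> \<and> supported_on \<nu> F \<and> 0 < ext_integral \<nu> u \<and> 0 < ext_integral \<nu> v"
    using needle_in_support[OF assms] by blast
qed

end
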